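(* Let $Y\in\mathbb{R}^{n\times(m+\ell)}$ satisfy $YY^T=I_n$. Let $\mathcal{S}_M\subseteq\{1,\dots,m+\ell\}$ with $|\mathcal{S}_M|=\ell$, let $M:=Y_{\mathcal{S}_M}\in\mathbb{R}^{n\times\ell}$, and set $r:=\operatorname{rank}(M)$. Then for any fixed integer $k$ with $n-r\le k\le m-1$ there exists a subset $\mathcal{S}_0\subseteq\{1,\dots,m+\ell\}\setminus\mathcal{S}_M$ with $|\mathcal{S}_0|=k$ such that $$\sigma_{\min}\big([M\ Y_{\mathcal{S}_0}]\big)^2\ge \Gamma(m,n,k,r)^{-1}\cdot\frac{m-n+r}{m-n+\|M^{\dagger}\|_F^2},$$ where $\Gamma(m,n,k,r)=\dfrac{m^2}{\big(\sqrt{(k+1)(m-n+r)}-\sqrt{(n-r)(m-k-1)}\big)^2}$.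
   Context: $Y_{\mathcal{S}}$ denotes the submatrix of $Y$ formed by the columns indexed by $\mathcal{S}$; $[M\ Y_{\mathcal{S}_0}]$ is horizontal concatenation. For an $n\times p$ matrix $Z$, $\sigma_{\min}(Z)^2$ denotes the smallest eigenvalue of $ZZ^T$ (the square of the $n$-th largest singular value). $M^{\dagger}$ is the Moore–Penrose pseudoinverse and $\|\cdot\|_F$ the Frobenius norm. *)

theory Defs
  imports
    Complex_Main
    "Jordan_Normal_Form.Char_Poly"
    "Jordan_Normal_Form.DL_Rank"
    "Jordan_Normal_Form.DL_Submatrix"
begin

text \<open>Column indices are 0-based, as everywhere for matrices of type \<^typ>\<open>'a mat\<close>:
  index sets are subsets of \<open>{0..<m + l}\<close>.\<close>

definition cols_submatrix :: "'a mat \<Rightarrow> nat set \<Rightarrow> 'a mat" where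
  "cols_submatrix Y S = submatrix Y UNIV S"

definition append_cols :: "'a :: zero mat \<Rightarrow> 'a mat \<Rightarrow> 'a mat" where
  "append_cols A B = four_block_mat A B (0\<^sub>m 0 (dim_col A)) (0\<^sub>m 0 (dim_col B))"

text \<open>The quantity \<open>\<sigma>\<^sub>m\<^sub>i\<^sub>n(Z)\<^sup>2\<close>. The set is finite, and it is nonempty when \<open>Z\<close> has at least
  one row, since \<open>Z Z\<^sup>T\<close> is symmetric. If \<open>Z\<close> has fewer columns than rows, the value is 0.\<close>

definition sigma_min_sq :: "real mat \<Rightarrow> real" where
  "sigma_min_sq Z = Min {e. eigenvalue (Z * transpose_mat Z) e}"

text \<open>The four Penrose conditions, which determine \<open>X\<close> uniquely.\<close>

definition is_pseudoinverse :: "real mat \<Rightarrow> real mat \<Rightarrow> bool" where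
  "is_pseudoinverse A X \<longleftrightarrow>
     X \<in> carrier_mat (dim_col A) (dim_row A) \<and>
     A * X * A = A \<and>
     X * A * X = X \<and>
     transpose_mat (A * X) = A * X \<and>
     transpose_mat (X * A) = X * A"

definition pseudoinverse :: "real mat \<Rightarrow> real mat" where
  "pseudoinverse A = (THE X. is_pseudoinverse A X)"

definition frobenius_norm :: "real mat \<Rightarrow> real" where
  "frobenius_norm A = sqrt (\<Sum>i<dim_row A. \<Sum>j<dim_col A. (A $$ (i, j))\<^sup>2)"

definition Gamma_factor :: "nat \<Rightarrow> nat \<Rightarrow> nat \<Rightarrow> nat \<Rightarrow> real" where
  "Gamma_factor m n k r =
     (real m)\<^sup>2 /
     (sqrt ((real k + 1) * (real m - real n + real r))
       - sqrt ((real n - real r) * (real m - real k - 1)))\<^sup>2"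

end

theory Submission
  imports Defs "Jordan_Normal_Form.Schur_Decomposition"
begin

text \<open>
  Let \<open>W\<close> consist of the \<open>m\<close> columns of \<open>Y\<close> outside \<open>S\<^sub>M\<close> and let \<open>C = 1 - W\<^sup>T W\<close>. If \<open>V\<close> consists of
  the columns of \<open>W\<close> that are not selected, then \<open>1 - V\<^sup>T V\<close> is a principal submatrix of \<open>C\<close>, and it has
  the same eigenvalues different from 1 as \<open>[M Y\<^sub>S] [M Y\<^sub>S]\<^sup>T = 1 - V V\<^sup>T\<close>. Hence selecting a column amounts
  to deleting a row and the corresponding column of \<open>C\<close>, and one has to find a principal submatrix of
  size \<open>m - k\<close> with a large smallest eigenvalue.

  For a symmetric matrix \<open>A\<close> with eigenvalues \<open>e\<^sub>i > x\<close> consider the barrier \<open>\<Phi>\<^sub>A(x) = \<Sum>\<^sub>i 1 / (e\<^sub>i - x)\<close>, the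
  negated logarithmic derivative of the characteristic polynomial. The derivative of the
  characteristic polynomial is the sum of those of the matrices with one row and column deleted, so
  an averaging argument shows that \<open>\<Phi>\<^sub>A(x) \<le> \<phi>\<close> implies \<open>\<Phi>\<^sub>B(x + 1/\<phi>) \<le> \<phi>\<close> for at least one of them.
  After \<open>k\<close> deletions starting at \<open>x = -t\<close> all eigenvalues are at least \<open>-t + (k + 1)/\<phi>\<close>.

  With \<open>a = n - r\<close>, \<open>b = m - a\<close> and \<open>c = b / (m - n + \<parallel>M\<^sup>\<dagger>\<parallel>\<^sup>2)\<close>, concavity of \<open>w \<mapsto> w / (1 + t w)\<close> allows to take
  \<open>\<phi> = a/t + b/(c + t)\<close>, and the supremum over \<open>t > 0\<close> is the claimed bound. It need not be attained,
  but there are only finitely many subsets.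
\<close>

section \<open>Real symmetric matrices\<close>

text \<open>With side conditions on dimensions instead of carriers, the simplifier can use
  associativity as a conditional rewrite rule in either direction.\<close>

lemma assoc_mult_mat_dim:
  fixes A B C :: "'a :: semiring_0 mat"
  assumes "dim_col A = dim_row B" and "dim_col B = dim_row C"
  shows "A * B * C = A * (B * C)"
  using assms by (intro assoc_mult_mat[of _ "dim_row A" "dim_row B" _ "dim_row C" _ "dim_col C"]) auto

lemma dim_mat_diag [simp]: "dim_row (mat_diag n f) = n" "dim_col (mat_diag n f) = n"
  by (simp_all add: mat_diag_def)

lemma transpose_mult_dim:
  fixes A B :: "'a :: comm_semiring_0 mat"
  assumes "dim_col A = dim_row B"
  shows "transpose_mat (A * B) = transpose_mat B * transpose_mat A"
  using assms by (intro transpose_mult[of _ "dim_row A" "dim_row B" _ "dim_col B"]) auto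

text \<open>A complex eigenvalue exists by the fundamental theorem of algebra. It is real because
  the Hermitian form of a real symmetric matrix takes only real values.\<close>

lemma real_symmetric_eigenvalue_exists:
  fixes A :: "real mat"
  assumes A: "A \<in> carrier_mat n n" and sym: "transpose_mat A = A" and n: "n > 0"
  shows "\<exists>e. eigenvalue A e"
proof -
  let ?A = "map_mat complex_of_real A"
  have A': "?A \<in> carrier_mat n n" using A by auto
  have "degree (char_poly ?A) \<noteq> 0"
    using degree_monic_char_poly[OF A'] n by auto
  then obtain z where z: "poly (char_poly ?A) z = 0"
    using fundamental_theorem_of_algebra constant_degree by metis
  then obtain v where v: "eigenvector ?A v z"
    using eigenvalue_root_char_poly[OF A'] unfolding eigenvalue_def by auto
  hence vc: "v \<in> carrier_vec n" and v0: "v \<noteq> 0\<^sub>v n" and Av: "?A *\<^sub>v v = z \<cdot>\<^sub>v v"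
    using A unfolding eigenvector_def by auto
  have sA: "A $$ (i,j) = A $$ (j,i)" if "i < n" "j < n" for i j
    using arg_cong[OF sym, of "\<lambda>M. M $$ (j,i)"] that A by auto
  \<comment> \<open>\<open>q\<close> is the Hermitian form of \<open>A\<close> at \<open>v\<close>
    and \<open>s\<close> the squared norm of \<open>v\<close>. From \<open>q = z * s\<close>,
    \<open>cnj q = q\<close> and \<open>s \<noteq> 0\<close> it follows that \<open>z\<close> is
    real.\<close>
  define q where "q = (\<Sum>i<n. \<Sum>j<n. of_real (A $$ (i,j)) * v $ j * cnj (v $ i))"
  define s where "s = (\<Sum>i<n. (cmod (v $ i))\<^sup>2)"
  have row: "(\<Sum>j<n. of_real (A $$ (i,j)) * v $ j) = z * v $ i" if "i < n" for i
  proof -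
    have "(?A *\<^sub>v v) $ i = (\<Sum>j<n. of_real (A $$ (i,j)) * v $ j)"
      using that A vc by (auto simp: scalar_prod_def atLeast0LessThan)
    thus ?thesis using Av that vc by auto
  qed
  have "q = (\<Sum>i<n. z * v $ i * cnj (v $ i))"
    unfolding q_def by (rule sum.cong) (auto simp: row sum_distrib_right[symmetric])
  also have "\<dots> = z * of_real s"
    unfolding s_def of_real_sum sum_distrib_left
    by (rule sum.cong) (simp_all only: complex_norm_square mult.assoc)
  finally have q: "q = z * of_real s" .
  have "cnj q = (\<Sum>i<n. \<Sum>j<n. of_real (A $$ (i,j)) * cnj (v $ j) * v $ i)"
    unfolding q_def by simp
  also have "\<dots> = (\<Sum>j<n. \<Sum>i<n. of_real (A $$ (i,j)) * cnj (v $ j) * v $ i)"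
    by (rule sum.swap)
  also have "\<dots> = q" unfolding q_def
    by (intro sum.cong refl) (auto simp: sA)
  finally have "cnj q = q" .
  hence "of_real s * (cnj z - z) = 0" unfolding q by (simp add: algebra_simps)
  moreover have "s \<noteq> 0"
  proof
    assume "s = 0"
    hence "\<forall>i\<in>{..<n}. (cmod (v $ i))\<^sup>2 = 0"
      unfolding s_def by (subst (asm) sum_nonneg_eq_0_iff) auto
    hence "v = 0\<^sub>v n" using vc by (intro eq_vecI) auto
    thus False using v0 by simp
  qed
  ultimately have "cnj z = z" by simp
  then obtain e where e: "z = of_real e" using Reals_cnj_iff Reals_cases by metis
  have "poly (char_poly A) e = 0"
    using z unfolding e of_real_hom.char_poly_hom[OF A] by simp
  thus ?thesis using eigenvalue_root_char_poly[OF A] by auto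
qed

text \<open>A basis starting with \<open>v\<close> is orthogonalised by Gram-Schmidt, which keeps
  its first vector. Normalising the result makes \<open>c\<close> the reciprocal of the length of
  \<open>v\<close>.\<close>

lemma orthogonal_mat_first_column:
  fixes v :: "real vec"
  assumes v: "v \<in> carrier_vec n" and v0: "v \<noteq> 0\<^sub>v n"
  shows "\<exists>W c. W \<in> carrier_mat n n \<and> transpose_mat W * W = 1\<^sub>m n \<and> W * transpose_mat W = 1\<^sub>m n
    \<and> col W 0 = c \<cdot>\<^sub>v v"
proof -
  interpret cof_vec_space n "TYPE(real)" .
  define b where "b = basis_completion v"
  define ws where "ws = gram_schmidt n b"
  from basis_completion[OF v v0, folded b_def]
  have dist_b: "distinct b" and indep: "\<not> lin_dep (set b)" and b: "set b \<subseteq> carrier_vec n"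
    and hdb: "hd b = v" and len_b: "length b = n" by auto
  have n: "n > 0" using v v0 by (cases n) (auto intro!: eq_vecI)
  from hdb len_b n obtain vs where bv: "b = v # vs" by (cases b, auto)
  from gram_schmidt_result[OF b dist_b indep refl, folded ws_def]
  have ws: "set ws \<subseteq> carrier_vec n" "corthogonal ws" "length ws = n"
    by (auto simp: len_b)
  from gram_schmidt_hd[OF v, of vs, folded bv] have hdws: "hd ws = v" unfolding ws_def .
  have w0: "ws ! 0 = v" using hdws ws n by (metis hd_conv_nth length_greater_0_conv)
  have wc: "ws ! i \<in> carrier_vec n" if "i < n" for i using ws that by auto
  have orth: "ws ! i \<bullet> ws ! j = 0 \<longleftrightarrow> i \<noteq> j" if "i < n" "j < n" for i j
    using corthogonalD[OF ws(2), of i j] that ws(3) by (simp add: vec_conjugate_real)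
  define s where "s i = sqrt (ws ! i \<bullet> ws ! i)" for i
  have pos: "ws ! i \<bullet> ws ! i > 0" if "i < n" for i
  proof -
    have "ws ! i \<bullet> ws ! i \<ge> 0" unfolding scalar_prod_def by (intro sum_nonneg) auto
    thus ?thesis using orth[OF that that] by linarith
  qed
  define W where "W = mat n n (\<lambda>(i,j). (ws ! j) $ i / s j)"
  have W: "W \<in> carrier_mat n n" unfolding W_def by auto
  have 1: "transpose_mat W * W = 1\<^sub>m n"
  proof (rule eq_matI)
    fix i j assume "i < dim_row (1\<^sub>m n :: real mat)" "j < dim_col (1\<^sub>m n :: real mat)"
    hence ij: "i < n" "j < n" by auto
    have "(transpose_mat W * W) $$ (i,j) = (\<Sum>k<n. (ws ! i) $ k * (ws ! j) $ k / (s i * s j))"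
      using ij W unfolding W_def by (auto simp: scalar_prod_def atLeast0LessThan)
    also have "\<dots> = (ws ! i \<bullet> ws ! j) / (s i * s j)"
      using wc[OF ij(1)] wc[OF ij(2)] by (simp add: scalar_prod_def sum_divide_distrib atLeast0LessThan)
    also have "\<dots> = (if i = j then 1 else 0)"
      using orth[OF ij] pos[OF ij(1)] unfolding s_def by auto
    finally show "(transpose_mat W * W) $$ (i,j) = 1\<^sub>m n $$ (i,j)" using ij by auto
  qed (use W in auto)
  have 2: "W * transpose_mat W = 1\<^sub>m n"
    using mat_mult_left_right_inverse[OF _ W 1] W by auto
  have 3: "col W 0 = (1 / s 0) \<cdot>\<^sub>v v"
    unfolding W_def w0[symmetric] using n wc[OF n] by (intro eq_vecI) auto
  show ?thesis using W 1 2 3 by blast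
qed

text \<open>The spectral theorem by deflation: an orthogonal change of basis moves one eigenvector
  to the first coordinate, and the induction hypothesis diagonalises the remaining block.\<close>

lemma real_symmetric_diagonalization:
  fixes A :: "real mat"
  assumes "A \<in> carrier_mat n n" and "transpose_mat A = A"
  shows "\<exists>U e. U \<in> carrier_mat n n \<and> transpose_mat U * U = 1\<^sub>m n \<and> U * transpose_mat U = 1\<^sub>m n
    \<and> A = U * mat_diag n e * transpose_mat U"
  using assms
proof (induction n arbitrary: A)
  case 0
  thus ?case by (intro exI[of _ "1\<^sub>m 0"]) (auto intro!: eq_matI)
next
  case (Suc n A)
  note A = Suc.prems(1) and sym = Suc.prems(2)
  from real_symmetric_eigenvalue_exists[OF A sym] obtain e0 v where "eigenvector A v e0"
    unfolding eigenvalue_def by auto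
  hence v: "v \<in> carrier_vec (Suc n)" "v \<noteq> 0\<^sub>v (Suc n)" and Av: "A *\<^sub>v v = e0 \<cdot>\<^sub>v v"
    using A unfolding eigenvector_def by auto
  from orthogonal_mat_first_column[OF v] obtain W c where
    W: "W \<in> carrier_mat (Suc n) (Suc n)" and W1: "transpose_mat W * W = 1\<^sub>m (Suc n)"
    and W2: "W * transpose_mat W = 1\<^sub>m (Suc n)" and c: "col W 0 = c \<cdot>\<^sub>v v" by auto
  have Wt: "transpose_mat W \<in> carrier_mat (Suc n) (Suc n)" using W by auto
  define B where "B = transpose_mat W * A * W"
  have B: "B \<in> carrier_mat (Suc n) (Suc n)" unfolding B_def using W A by auto
  have symB: "transpose_mat B = B" unfolding B_def
    using W A Wt sym by (simp add: transpose_mult_dim assoc_mult_mat_dim)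
  have sB: "B $$ (i,j) = B $$ (j,i)" if "i < Suc n" "j < Suc n" for i j
    using arg_cong[OF symB, of "\<lambda>M. M $$ (j,i)"] that B by auto
  \<comment> \<open>The first column of \<open>W\<close> is an eigenvector, so the first column of
    \<open>B\<close> is \<open>e0\<close> times the first unit vector. Symmetry then clears the
    first row as well.\<close>
  have colB: "B $$ (i,0) = (if i = 0 then e0 else 0)" if i: "i < Suc n" for i
  proof -
    have "col B 0 = transpose_mat W *\<^sub>v (A *\<^sub>v col W 0)"
      unfolding B_def assoc_mult_mat[OF Wt A W]
      using col_mult2[OF Wt mult_carrier_mat[OF A W], of 0] col_mult2[OF A W, of 0] by simp
    also have "A *\<^sub>v col W 0 = e0 \<cdot>\<^sub>v col W 0"
      unfolding c using A v Av by (simp add: mult_mat_vec smult_smult_assoc mult.commute)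
    also have "transpose_mat W *\<^sub>v (e0 \<cdot>\<^sub>v col W 0) = e0 \<cdot>\<^sub>v col (transpose_mat W * W) 0"
      using mult_mat_vec[OF Wt, of "col W 0" e0] col_carrier_vec[OF _ W, of 0]
        col_mult2[OF Wt W, of 0] by simp
    finally have "col B 0 = e0 \<cdot>\<^sub>v col (1\<^sub>m (Suc n)) 0" unfolding W1 .
    hence "col B 0 $ i = (e0 \<cdot>\<^sub>v col (1\<^sub>m (Suc n)) 0) $ i" by simp
    thus ?thesis using i B by auto
  qed
  define C where "C = mat n n (\<lambda>(i,j). B $$ (Suc i, Suc j))"
  have C: "C \<in> carrier_mat n n" unfolding C_def by auto
  have symC: "transpose_mat C = C" unfolding C_def by (rule eq_matI) (auto simp: sB)
  have Bblock: "B = four_block_mat (mat 1 1 (\<lambda>_. e0)) (0\<^sub>m 1 n) (0\<^sub>m n 1) C"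
    by (rule eq_matI) (use B colB sB[of 0] in \<open>auto simp: C_def split: if_splits\<close>)
  from Suc.IH[OF C symC] obtain U e where U: "U \<in> carrier_mat n n"
    and U1: "transpose_mat U * U = 1\<^sub>m n" and U2: "U * transpose_mat U = 1\<^sub>m n"
    and CU: "C = U * mat_diag n e * transpose_mat U" by auto
  define V where "V = four_block_mat (1\<^sub>m 1) (0\<^sub>m 1 n) (0\<^sub>m n 1) U"
  have V: "V \<in> carrier_mat (Suc n) (Suc n)" unfolding V_def using U four_block_carrier_mat[of "1\<^sub>m 1" 1 1 U n n] by simp
  have Vt: "transpose_mat V = four_block_mat (1\<^sub>m 1) (0\<^sub>m 1 n) (0\<^sub>m n 1) (transpose_mat U)"
    unfolding V_def using U by (subst transpose_four_block_mat[of _ 1 1 _ n _ n]) auto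
  have Vtc: "transpose_mat V \<in> carrier_mat (Suc n) (Suc n)" using V by auto
  have one: "four_block_mat (1\<^sub>m 1) (0\<^sub>m 1 n) (0\<^sub>m n 1) (1\<^sub>m n) = (1\<^sub>m (Suc n) :: real mat)"
    using four_block_one_mat[of 1 n] by simp
  have V1: "transpose_mat V * V = 1\<^sub>m (Suc n)"
    unfolding Vt unfolding V_def using U U1 one
    by (subst mult_four_block_mat[of _ 1 1 _ n _ n _ _ 1 _ n]) auto
  have V2: "V * transpose_mat V = 1\<^sub>m (Suc n)"
    unfolding Vt unfolding V_def using U U2 one
    by (subst mult_four_block_mat[of _ 1 1 _ n _ n _ _ 1 _ n]) auto
  define f where "f i = (case i of 0 \<Rightarrow> e0 | Suc j \<Rightarrow> e j)" for i
  have Df: "mat_diag (Suc n) f = four_block_mat (mat 1 1 (\<lambda>_. e0)) (0\<^sub>m 1 n) (0\<^sub>m n 1) (mat_diag n e)"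
    by (rule eq_matI) (auto simp: mat_diag_def f_def split: nat.splits)
  have BV: "B = V * mat_diag (Suc n) f * transpose_mat V"
  proof -
    have UD: "U * mat_diag n e \<in> carrier_mat n n" using U by auto
    have VD: "V * mat_diag (Suc n) f
        = four_block_mat (mat 1 1 (\<lambda>_. e0)) (0\<^sub>m 1 n) (0\<^sub>m n 1) (U * mat_diag n e)"
      unfolding V_def Df using U UD left_mult_zero_mat[OF mat_diag_dim, of 1 n e]
      by (subst mult_four_block_mat[of _ 1 1 _ n _ n _ _ 1 _ n]) auto
    show ?thesis unfolding VD unfolding Vt Bblock CU using U UD right_mult_zero_mat[OF UD, of 1]
      by (subst mult_four_block_mat[of _ 1 1 _ n _ n _ _ 1 _ n]) auto
  qed
  have "A = (W * transpose_mat W) * A * (W * transpose_mat W)" unfolding W2 using A by simp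
  also have "\<dots> = W * B * transpose_mat W"
    unfolding B_def using W Wt A by (simp add: assoc_mult_mat_dim)
  also have "\<dots> = (W * V) * mat_diag (Suc n) f * transpose_mat (W * V)"
    unfolding BV using W Wt V Vtc mat_diag_dim[of "Suc n" f]
    by (simp add: assoc_mult_mat_dim transpose_mult_dim)
  finally have fin: "A = (W * V) * mat_diag (Suc n) f * transpose_mat (W * V)" .
  have o1: "transpose_mat (W * V) * (W * V) = 1\<^sub>m (Suc n)"
  proof -
    have "transpose_mat (W * V) * (W * V) = transpose_mat V * (transpose_mat W * W) * V"
      using W Wt V Vtc by (simp add: assoc_mult_mat_dim transpose_mult_dim)
    thus ?thesis unfolding W1 using V1 Vtc by simp
  qed
  have WV: "W * V \<in> carrier_mat (Suc n) (Suc n)" using W V by auto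
  have o2: "(W * V) * transpose_mat (W * V) = 1\<^sub>m (Suc n)"
    using mat_mult_left_right_inverse[OF _ WV o1] WV by auto
  show ?case using WV o1 o2 fin by blast
qed

section \<open>Characteristic polynomials and quadratic forms in an eigenbasis\<close>

lemma char_poly_mat_diag_conjugate:
  fixes U :: "real mat"
  assumes U: "U \<in> carrier_mat n n" and U1: "transpose_mat U * U = 1\<^sub>m n"
    and U2: "U * transpose_mat U = 1\<^sub>m n"
  shows "char_poly (U * mat_diag n e * transpose_mat U) = (\<Prod>i<n. [:- e i, 1:])"
proof -
  have "similar_mat (U * mat_diag n e * transpose_mat U) (mat_diag n e)"
    unfolding similar_mat_def similar_mat_wit_def
    by (rule exI[of _ U], rule exI[of _ "transpose_mat U"]) (use U U1 U2 in \<open>auto simp: Let_def\<close>)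
  hence "char_poly (U * mat_diag n e * transpose_mat U) = char_poly (mat_diag n e)"
    by (rule char_poly_similar)
  also have "\<dots> = (\<Prod>a\<leftarrow>diag_mat (mat_diag n e). [:- a, 1:])"
    by (rule char_poly_upper_triangular[of _ n]) (auto simp: mat_diag_def)
  also have "\<dots> = (\<Prod>i<n. [:- e i, 1:])"
    by (simp add: diag_mat_def mat_diag_def prod.list_conv_set_nth atLeast0LessThan)
  finally show ?thesis .
qed

lemma eigenvalue_iff_factor:
  fixes A :: "'a :: field mat"
  assumes "A \<in> carrier_mat n n" and "char_poly A = (\<Prod>i<n. [:- e i, 1:])"
  shows "eigenvalue A x \<longleftrightarrow> (\<exists>i<n. x = e i)"
  unfolding eigenvalue_root_char_poly[OF assms(1)] assms(2)
  by (auto simp: poly_prod)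

text \<open>In the coordinates \<open>w\<close> of \<open>v\<close> in an orthonormal eigenbasis,
  the form is a sum of squares weighted by the eigenvalues.\<close>

lemma symmetric_quadratic_form_greater:
  fixes A :: "real mat"
  assumes A: "A \<in> carrier_mat n n" and sym: "transpose_mat A = A"
    and ev: "\<And>e. eigenvalue A e \<Longrightarrow> e > x"
    and v: "v \<in> carrier_vec n" and v0: "v \<noteq> 0\<^sub>v n"
  shows "v \<bullet> (A *\<^sub>v v) > x * (v \<bullet> v)"
proof -
  from real_symmetric_diagonalization[OF A sym] obtain U e where
    U: "U \<in> carrier_mat n n" and U1: "transpose_mat U * U = 1\<^sub>m n"
    and U2: "U * transpose_mat U = 1\<^sub>m n" and AU: "A = U * mat_diag n e * transpose_mat U" by blast
  have e: "e i > x" if "i < n" for i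
    using ev eigenvalue_iff_factor[OF A] that
    unfolding AU char_poly_mat_diag_conjugate[OF U U1 U2] by auto
  define w where "w = transpose_mat U *\<^sub>v v"
  have w: "w \<in> carrier_vec n" unfolding w_def using U v by auto
  have Uw: "U *\<^sub>v w = v" unfolding w_def using U v U2
    by (metis assoc_mult_mat_vec one_mult_mat_vec transpose_carrier_mat)
  have vw: "v \<bullet> (U *\<^sub>v y) = w \<bullet> y" if "y \<in> carrier_vec n" for y
    unfolding w_def using transpose_vec_mult_scalar[OF U that v] U v that
    by (metis comm_scalar_prod mult_mat_vec_carrier transpose_carrier_mat)
  have "A *\<^sub>v v = U *\<^sub>v (mat_diag n e *\<^sub>v w)"
  proof -
    have "A *\<^sub>v v = U * mat_diag n e *\<^sub>v w" unfolding AU w_def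
      by (rule assoc_mult_mat_vec[of _ n n _ n]) (use U v in auto)
    also have "\<dots> = U *\<^sub>v (mat_diag n e *\<^sub>v w)"
      by (rule assoc_mult_mat_vec[of _ n n _ n]) (use U w in auto)
    finally show ?thesis .
  qed
  hence "v \<bullet> (A *\<^sub>v v) = w \<bullet> (mat_diag n e *\<^sub>v w)"
    using vw[of "mat_diag n e *\<^sub>v w"] w by (simp add: mult_mat_vec_carrier[OF mat_diag_dim])
  also have "\<dots> = (\<Sum>i<n. w $ i * (mat_diag n e *\<^sub>v w) $ i)"
    using w by (simp add: scalar_prod_def atLeast0LessThan)
  also have "\<dots> = (\<Sum>i<n. e i * (w $ i)\<^sup>2)"
  proof (rule sum.cong[OF refl])
    fix i assume "i \<in> {..<n}"
    hence i: "i < n" by simp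
    have "(mat_diag n e *\<^sub>v w) $ i = (\<Sum>j<n. (if i = j then e j else 0) * w $ j)"
      using i w by (simp add: mat_diag_def scalar_prod_def atLeast0LessThan)
    also have "\<dots> = e i * w $ i" using i by (simp add: if_distrib[of "\<lambda>c. c * _"] cong: if_cong)
    finally show "w $ i * (mat_diag n e *\<^sub>v w) $ i = e i * (w $ i)\<^sup>2"
      by (simp add: power2_eq_square)
  qed
  finally have q: "v \<bullet> (A *\<^sub>v v) = (\<Sum>i<n. e i * (w $ i)\<^sup>2)" .
  have "v \<bullet> v = w \<bullet> w" using vw[OF w] unfolding Uw .
  hence s: "v \<bullet> v = (\<Sum>i<n. (w $ i)\<^sup>2)"
    using w by (simp add: scalar_prod_def atLeast0LessThan power2_eq_square)
  have "w \<noteq> 0\<^sub>v n" using Uw v0 U by auto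
  then obtain k where k: "k < n" "w $ k \<noteq> 0" using w by (metis eq_vecI carrier_vecD index_zero_vec)
  have "(\<Sum>i<n. x * (w $ i)\<^sup>2) < (\<Sum>i<n. e i * (w $ i)\<^sup>2)"
  proof (rule sum_strict_mono_ex1)
    show "\<forall>i\<in>{..<n}. x * (w $ i)\<^sup>2 \<le> e i * (w $ i)\<^sup>2"
      using e by (auto intro!: mult_right_mono simp: less_imp_le)
    show "\<exists>i\<in>{..<n}. x * (w $ i)\<^sup>2 < e i * (w $ i)\<^sup>2"
      using k e[of k] by (intro bexI[of _ k]) auto
  qed simp
  thus ?thesis unfolding q s by (simp add: sum_distrib_left)
qed

section \<open>Deleting one row and the corresponding column\<close>

lemma sum_insert_index:
  assumes "i < Suc d" and "f i = (0 :: 'a :: comm_monoid_add)"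
  shows "(\<Sum>a<d. f (insert_index i a)) = (\<Sum>j<Suc d. f j)"
proof -
  have "(\<Sum>a<d. f (insert_index i a)) = sum f (insert_index i ` {..<d})"
    by (subst sum.reindex) (auto simp: insert_index_inj_on)
  also have "insert_index i ` {..<d} = {..<Suc d} - {i}"
    using insert_index_image[of i d] assms by (simp add: atLeast0LessThan)
  also have "sum f ({..<Suc d} - {i}) = sum f {..<Suc d}"
    using assms by (subst (2) sum.remove[of _ i]) auto
  finally show ?thesis .
qed

lemma mat_delete_diagonal_index:
  assumes "A \<in> carrier_mat (Suc d) (Suc d)" and "i < Suc d" and "a < d" and "b < d"
  shows "mat_delete A i i $$ (a,b) = A $$ (insert_index i a, insert_index i b)"
  using mat_delete_index[of A d i i a b] assms by simp

text \<open>The lower half of Cauchy interlacing: an eigenvector of the smaller matrix, padded with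
  a zero at \<open>i\<close>, is a test vector for the quadratic form of \<open>A\<close>.\<close>

lemma mat_delete_eigenvalue_greater:
  fixes A :: "real mat"
  assumes A: "A \<in> carrier_mat (Suc d) (Suc d)" and sym: "transpose_mat A = A"
    and ev: "\<And>e. eigenvalue A e \<Longrightarrow> e > x" and i: "i < Suc d"
    and e: "eigenvalue (mat_delete A i i) e"
  shows "e > x"
proof -
  let ?B = "mat_delete A i i"
  have B: "?B \<in> carrier_mat d d" using mat_delete_carrier[OF A] by simp
  from e obtain v where v: "v \<in> carrier_vec d" and v0: "v \<noteq> 0\<^sub>v d" and Bv: "?B *\<^sub>v v = e \<cdot>\<^sub>v v"
    using B unfolding eigenvalue_def eigenvector_def by auto
  define w where "w = vec (Suc d) (\<lambda>j. if j = i then 0 else v $ (delete_index i j))"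
  have w: "w \<in> carrier_vec (Suc d)" unfolding w_def by auto
  have wi: "w $ i = 0" unfolding w_def using i by simp
  have ii: "insert_index i a < Suc d" "insert_index i a \<noteq> i" if "a < d" for a
    using that i by (auto simp: insert_index_def)
  have wv: "w $ (insert_index i a) = v $ a" if "a < d" for a
    unfolding w_def using ii[OF that] by simp
  have sw: "(\<Sum>j<Suc d. w $ j * c j) = (\<Sum>a<d. v $ a * c (insert_index i a))" for c
    using sum_insert_index[OF i, of "\<lambda>j. w $ j * c j"] wi wv by simp
  have ww: "w \<bullet> w = v \<bullet> v"
    using w v sw[of "\<lambda>j. w $ j"] wv by (simp add: scalar_prod_def atLeast0LessThan del: sum.lessThan_Suc)
  have row: "(A *\<^sub>v w) $ (insert_index i a) = e * v $ a" if a: "a < d" for a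
  proof -
    have "(A *\<^sub>v w) $ (insert_index i a) = (\<Sum>j<Suc d. w $ j * A $$ (insert_index i a, j))"
      using A w ii[OF a] by (simp add: scalar_prod_def atLeast0LessThan mult.commute del: sum.lessThan_Suc)
    also have "\<dots> = (\<Sum>b<d. ?B $$ (a,b) * v $ b)"
      unfolding sw using mat_delete_diagonal_index[OF A i a] by (simp add: mult.commute)
    also have "\<dots> = (?B *\<^sub>v v) $ a" using a A B v by (simp add: scalar_prod_def atLeast0LessThan)
    finally show ?thesis unfolding Bv using a v by simp
  qed
  have "w \<bullet> (A *\<^sub>v w) = (\<Sum>j<Suc d. w $ j * (A *\<^sub>v w) $ j)"
    using w A by (simp add: scalar_prod_def atLeast0LessThan del: sum.lessThan_Suc)
  also have "\<dots> = (\<Sum>a<d. v $ a * (e * v $ a))" unfolding sw using row by simp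
  also have "\<dots> = e * (v \<bullet> v)" using v by (simp add: scalar_prod_def atLeast0LessThan sum_distrib_left algebra_simps)
  finally have q: "w \<bullet> (A *\<^sub>v w) = e * (v \<bullet> v)" .
  have w0: "w \<noteq> 0\<^sub>v (Suc d)"
  proof
    assume "w = 0\<^sub>v (Suc d)"
    hence "v $ a = 0" if "a < d" for a using wv[OF that] ii[OF that] by simp
    hence "v = 0\<^sub>v d" using v by (intro eq_vecI) auto
    thus False using v0 by simp
  qed
  have "v \<bullet> v \<ge> 0" unfolding scalar_prod_def by (intro sum_nonneg) auto
  moreover from symmetric_quadratic_form_greater[OF A sym ev w w0]
  have "x * (v \<bullet> v) < e * (v \<bullet> v)" unfolding q ww .
  ultimately show ?thesis using mult_right_mono[of e x "v \<bullet> v"] by linarith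
qed

section \<open>The barrier argument\<close>

text \<open>Here \<open>a i\<close> is the distance from the barrier point to an eigenvalue, and
  \<open>1 / \<phi>\<close> is the shift. With two or more terms each \<open>1 / a i\<close> is
  strictly below \<open>\<phi>\<close>, so the shift reaches no eigenvalue. The left side of the
  second claim is the second derivative of the characteristic polynomial at the shifted point,
  divided by its value there.\<close>

lemma barrier_shift_inequality:
  fixes a :: "'i \<Rightarrow> real"
  assumes fin: "finite I" and card: "card I \<ge> 2" and pos: "\<And>i. i \<in> I \<Longrightarrow> a i > 0"
    and le: "(\<Sum>i\<in>I. 1 / a i) \<le> \<phi>"
  shows "\<And>i. i \<in> I \<Longrightarrow> 1 / \<phi> < a i"
    and "(\<Sum>i\<in>I. 1 / (a i - 1 / \<phi>))\<^sup>2 - (\<Sum>i\<in>I. (1 / (a i - 1 / \<phi>))\<^sup>2)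
      \<le> \<phi> * (\<Sum>i\<in>I. 1 / (a i - 1 / \<phi>))"
proof -
  have lt: "1 / a i < \<phi>" if i: "i \<in> I" for i
  proof -
    have "card (I - {i}) > 0" using card i fin by simp
    hence "I - {i} \<noteq> {}" by (metis card.empty less_numeral_extra(3))
    hence "(\<Sum>j\<in>I - {i}. 1 / a j) > 0" using fin pos by (intro sum_pos) auto
    thus ?thesis using le sum.remove[OF fin i, of "\<lambda>j. 1 / a j"] by simp
  qed
  have "I \<noteq> {}" using card by auto
  then obtain i0 where "i0 \<in> I" by auto
  hence phi: "\<phi> > 0" using lt[of i0] pos[of i0] by (smt (verit) divide_pos_pos)
  show gt: "1 / \<phi> < a i" if "i \<in> I" for i
    using lt[OF that] pos[OF that] phi by (simp add: field_simps)
  \<comment> \<open>The \<open>w i\<close> are weights of total at most 1. The shifted reciprocals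
    are \<open>\<phi> * (w i * y i)\<close>, and \<open>y i\<close> satisfies
    \<open>w i * (y i)\<^sup>2 - (w i * y i)\<^sup>2 = w i * y i\<close>.\<close>
  define w where "w i = 1 / (\<phi> * a i)" for i
  define y where "y i = 1 / (1 - w i)" for i
  have w: "0 < w i" "w i < 1" if "i \<in> I" for i
    using gt[OF that] phi pos[OF that] unfolding w_def by (auto simp: field_simps)
  have sw: "(\<Sum>i\<in>I. w i) \<le> 1"
  proof -
    have "(\<Sum>i\<in>I. w i) = (\<Sum>i\<in>I. 1 / a i) / \<phi>" unfolding w_def sum_divide_distrib by (simp add: mult.commute)
    thus ?thesis using le phi by simp
  qed
  have u: "1 / (a i - 1 / \<phi>) = \<phi> * (w i * y i)" if "i \<in> I" for i
    using gt[OF that] w[OF that] phi pos[OF that] unfolding w_def y_def by (simp add: field_simps)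
  have "(\<Sum>i\<in>I. w i * y i)\<^sup>2 \<le> (\<Sum>i\<in>I. w i * (y i)\<^sup>2)"
  proof -
    \<comment> \<open>Cauchy-Schwarz for weights of total at most 1, obtained from the nonnegative
      weighted sum of squared deviations from \<open>c\<close>.\<close>
    define c where "c = (\<Sum>i\<in>I. w i * y i)"
    have "0 \<le> (\<Sum>i\<in>I. w i * (y i - c)\<^sup>2)"
      by (intro sum_nonneg mult_nonneg_nonneg) (use w in \<open>auto simp: less_imp_le\<close>)
    also have "\<dots> = (\<Sum>i\<in>I. w i * (y i)\<^sup>2 - 2 * c * (w i * y i) + c\<^sup>2 * w i)"
      by (intro sum.cong) (auto simp: power2_eq_square algebra_simps)
    also have "\<dots> = (\<Sum>i\<in>I. w i * (y i)\<^sup>2) - 2 * c * c + c\<^sup>2 * (\<Sum>i\<in>I. w i)"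
      unfolding c_def by (simp add: sum.distrib sum_subtractf sum_distrib_left)
    also have "c\<^sup>2 * (\<Sum>i\<in>I. w i) \<le> c\<^sup>2 * 1" by (rule mult_left_mono[OF sw]) simp
    finally show ?thesis unfolding c_def[symmetric] by (simp add: power2_eq_square)
  qed
  hence "(\<Sum>i\<in>I. w i * y i)\<^sup>2 - (\<Sum>i\<in>I. (w i * y i)\<^sup>2)
      \<le> (\<Sum>i\<in>I. w i * (y i)\<^sup>2 - (w i * y i)\<^sup>2)" by (simp add: sum_subtractf)
  also have "\<dots> = (\<Sum>i\<in>I. w i * y i)"
  proof (rule sum.cong[OF refl])
    fix i assume "i \<in> I"
    hence "y i * (1 - w i) = 1" using w(2)[of i] unfolding y_def by simp
    moreover have "w i * (y i)\<^sup>2 - (w i * y i)\<^sup>2 = w i * y i * (y i * (1 - w i))"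
      by (simp add: power2_eq_square algebra_simps)
    ultimately show "w i * (y i)\<^sup>2 - (w i * y i)\<^sup>2 = w i * y i" by simp
  qed
  finally have "\<phi>\<^sup>2 * ((\<Sum>i\<in>I. w i * y i)\<^sup>2 - (\<Sum>i\<in>I. (w i * y i)\<^sup>2)) \<le> \<phi>\<^sup>2 * (\<Sum>i\<in>I. w i * y i)"
    by (rule mult_left_mono) simp
  moreover have "(\<Sum>i\<in>I. 1 / (a i - 1 / \<phi>)) = \<phi> * (\<Sum>i\<in>I. w i * y i)"
    by (simp add: u sum_distrib_left)
  moreover have "(\<Sum>i\<in>I. (1 / (a i - 1 / \<phi>))\<^sup>2) = \<phi>\<^sup>2 * (\<Sum>i\<in>I. (w i * y i)\<^sup>2)"
    unfolding sum_distrib_left by (rule sum.cong[OF refl]) (simp only: u power_mult_distrib)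
  ultimately show "(\<Sum>i\<in>I. 1 / (a i - 1 / \<phi>))\<^sup>2 - (\<Sum>i\<in>I. (1 / (a i - 1 / \<phi>))\<^sup>2)
      \<le> \<phi> * (\<Sum>i\<in>I. 1 / (a i - 1 / \<phi>))"
    by (simp add: power_mult_distrib algebra_simps power2_eq_square)
qed

text \<open>These are p'/p and p''/p = (p'/p)^2 + (p'/p)', multiplied by p. The induction adds one
  linear factor at a time with the product rule.\<close>

lemma pderiv_prod_linear:
  fixes e :: "'i \<Rightarrow> real"
  assumes "finite I" and "\<And>i. i \<in> I \<Longrightarrow> e i \<noteq> x"
  defines "p \<equiv> \<lambda>I. \<Prod>i\<in>I. [:- e i, 1:]"
  shows "poly (pderiv (p I)) x = - poly (p I) x * (\<Sum>i\<in>I. 1 / (e i - x))"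
    and "poly (pderiv (pderiv (p I))) x
      = poly (p I) x * ((\<Sum>i\<in>I. 1 / (e i - x))\<^sup>2 - (\<Sum>i\<in>I. (1 / (e i - x))\<^sup>2))"
proof -
  have "poly (pderiv (p I)) x = - poly (p I) x * (\<Sum>i\<in>I. 1 / (e i - x))
    \<and> poly (pderiv (pderiv (p I))) x
      = poly (p I) x * ((\<Sum>i\<in>I. 1 / (e i - x))\<^sup>2 - (\<Sum>i\<in>I. (1 / (e i - x))\<^sup>2))"
    using assms(1,2)
  proof (induction I rule: finite_induct)
    case empty
    thus ?case by (simp add: p_def pderiv_1)
  next
    case (insert j I)
    define s where "s = (\<Sum>i\<in>I. 1 / (e i - x))"
    define s2 where "s2 = (\<Sum>i\<in>I. (1 / (e i - x))\<^sup>2)"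
    define P where "P = poly (p I) x"
    have pI: "p (insert j I) = [:- e j, 1:] * p I" unfolding p_def using insert by simp
    have IH: "poly (pderiv (p I)) x = - P * s"
      "poly (pderiv (pderiv (p I))) x = P * (s\<^sup>2 - s2)"
      using insert unfolding s_def s2_def P_def by auto
    have d: "pderiv [:- e j, 1:] = 1" by (simp add: pderiv_pCons)
    have d1: "pderiv (p (insert j I)) = p I + [:- e j, 1:] * pderiv (p I)"
      unfolding pI pderiv_mult d by (simp add: algebra_simps)
    have d2: "pderiv (pderiv (p (insert j I))) = 2 * pderiv (p I) + [:- e j, 1:] * pderiv (pderiv (p I))"
      unfolding d1 pderiv_add pderiv_mult d by (simp add: algebra_simps)
    define u where "u = 1 / (e j - x)"
    have xe: "x - e j \<noteq> 0" "(x - e j) * u = -1" using insert unfolding u_def by (auto simp: field_simps)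
    have v0: "poly (p (insert j I)) x = (x - e j) * P" unfolding pI P_def by (simp add: algebra_simps)
    have v1: "poly (pderiv (p (insert j I))) x = P - (x - e j) * P * s"
      unfolding d1 poly_add poly_mult IH by (simp add: P_def algebra_simps)
    have v2: "poly (pderiv (pderiv (p (insert j I)))) x = - 2 * P * s + (x - e j) * P * (s\<^sup>2 - s2)"
      unfolding d2 poly_add poly_mult IH by (simp add: algebra_simps)
    have s': "(\<Sum>i\<in>insert j I. 1 / (e i - x)) = u + s"
      "(\<Sum>i\<in>insert j I. (1 / (e i - x))\<^sup>2) = u\<^sup>2 + s2"
      using insert unfolding s_def s2_def u_def by auto
    have "- ((x - e j) * P) * (u + s) = - ((x - e j) * u) * P - (x - e j) * P * s"
      by (simp add: algebra_simps)
    moreover have "(x - e j) * P * ((u + s)\<^sup>2 - (u\<^sup>2 + s2)) = 2 * ((x - e j) * u) * P * s + (x - e j) * P * (s\<^sup>2 - s2)"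
      by (simp add: algebra_simps power2_eq_square)
    ultimately show ?case unfolding v0 v1 v2 s' xe(2) by simp
  qed
  thus "poly (pderiv (p I)) x = - poly (p I) x * (\<Sum>i\<in>I. 1 / (e i - x))"
    and "poly (pderiv (pderiv (p I))) x
      = poly (p I) x * ((\<Sum>i\<in>I. 1 / (e i - x))\<^sup>2 - (\<Sum>i\<in>I. (1 / (e i - x))\<^sup>2))" by auto
qed

text \<open>Expressed by the characteristic polynomial, so that no enumeration of the eigenvalues is
  chosen and the formula for the derivative of \<open>char_poly\<close> by deleted matrices applies
  directly.\<close>

definition barrier :: "real mat \<Rightarrow> real \<Rightarrow> real" where
  "barrier A x = - poly (pderiv (char_poly A)) x / poly (char_poly A) x"

lemma barrier_eq_sum:
  fixes n :: nat
  assumes cp: "char_poly A = (\<Prod>i<n. [:- e i, 1:])" and e: "\<And>i. i < n \<Longrightarrow> e i \<noteq> x"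
  shows "barrier A x = (\<Sum>i<n. 1 / (e i - x))"
proof -
  have "poly (\<Prod>i<n. [:- e i, 1:]) x \<noteq> 0" using e by (auto simp: poly_prod)
  moreover have "poly (pderiv (\<Prod>i<n. [:- e i, 1:])) x
      = - poly (\<Prod>i<n. [:- e i, 1:]) x * (\<Sum>i<n. 1 / (e i - x))"
    by (rule pderiv_prod_linear) (use e in auto)
  ultimately show ?thesis unfolding barrier_def cp by simp
qed

lemma symmetric_char_poly_factors:
  fixes A :: "real mat"
  assumes A: "A \<in> carrier_mat n n" and sym: "transpose_mat A = A"
  obtains e where "char_poly A = (\<Prod>i<n. [:- e i, 1:])"
    and "\<And>x. eigenvalue A x \<longleftrightarrow> (\<exists>i<n. x = e i)"
proof -
  from real_symmetric_diagonalization[OF A sym] obtain U e where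
    "U \<in> carrier_mat n n" "transpose_mat U * U = 1\<^sub>m n"
    "U * transpose_mat U = 1\<^sub>m n" "A = U * mat_diag n e * transpose_mat U" by blast
  hence cp: "char_poly A = (\<Prod>i<n. [:- e i, 1:])" using char_poly_mat_diag_conjugate by blast
  show ?thesis using that[OF cp eigenvalue_iff_factor[OF A cp]] .
qed

text \<open>Every factor \<open>x - e i\<close> is negative. The sign turns values of characteristic
  polynomials into positive weights for the averaging argument.\<close>

lemma prod_below_roots_sign:
  fixes e :: "nat \<Rightarrow> real"
  assumes "\<And>i. i < n \<Longrightarrow> e i > x"
  shows "(-1) ^ n * poly (\<Prod>i<n. [:- e i, 1:]) x > 0"
  using assms
proof (induction n)
  case (Suc n)
  have "(-1) ^ Suc n * poly (\<Prod>i<Suc n. [:- e i, 1:]) x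
      = ((-1) ^ n * poly (\<Prod>i<n. [:- e i, 1:]) x) * (e n - x)"
    by (simp add: algebra_simps)
  thus ?case using Suc by (simp only:) (simp add: mult_pos_pos)
qed simp

lemma symmetric_mat_delete:
  assumes A: "A \<in> carrier_mat (Suc d) (Suc d)" and sym: "transpose_mat A = A" and i: "i < Suc d"
  shows "transpose_mat (mat_delete A i i) = mat_delete A i i"
proof (rule eq_matI)
  fix a b assume "a < dim_row (mat_delete A i i)" "b < dim_col (mat_delete A i i)"
  hence ab: "a < d" "b < d" using A by auto
  have ii: "insert_index i c < Suc d" if "c < d" for c using that by (auto simp: insert_index_def)
  have "transpose_mat (mat_delete A i i) $$ (a,b) = mat_delete A i i $$ (b,a)"
    using ab A by simp
  also have "\<dots> = A $$ (insert_index i b, insert_index i a)"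
    by (rule mat_delete_diagonal_index[OF A i ab(2,1)])
  also have "\<dots> = transpose_mat A $$ (insert_index i a, insert_index i b)"
    using A ii[OF ab(1)] ii[OF ab(2)] by simp
  also have "\<dots> = mat_delete A i i $$ (a,b)"
    unfolding sym by (rule mat_delete_diagonal_index[OF A i ab, symmetric])
  finally show "transpose_mat (mat_delete A i i) $$ (a,b) = mat_delete A i i $$ (a,b)" .
qed (use A in auto)

text \<open>By interlacing, all deleted matrices keep their spectrum above the shifted point. Their
  characteristic polynomials therefore have the same sign there and can serve as weights of a mean.
  The condition \<open>d \<ge> 1\<close> provides the two eigenvalues that the shift inequality
  requires.\<close>

lemma barrier_step:
  fixes A :: "real mat"
  assumes A: "A \<in> carrier_mat (Suc d) (Suc d)" and d: "d \<ge> 1" and sym: "transpose_mat A = A"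
    and ev: "\<And>e. eigenvalue A e \<Longrightarrow> e > x" and bar: "barrier A x \<le> \<phi>"
  shows "\<exists>i<Suc d. (\<forall>e. eigenvalue (mat_delete A i i) e \<longrightarrow> e > x + 1 / \<phi>)
    \<and> barrier (mat_delete A i i) (x + 1 / \<phi>) \<le> \<phi>"
proof -
  define x' where "x' = x + 1 / \<phi>"
  obtain e where cp: "char_poly A = (\<Prod>i<Suc d. [:- e i, 1:])"
    and evA: "\<And>x. eigenvalue A x \<longleftrightarrow> (\<exists>i<Suc d. x = e i)"
    using symmetric_char_poly_factors[OF A sym] by blast
  have ex: "e i > x" if "i < Suc d" for i using ev evA that by blast
  have bs: "barrier A x = (\<Sum>i<Suc d. 1 / (e i - x))"
    by (rule barrier_eq_sum[OF cp]) (use ex in \<open>auto simp: less_imp_neq[symmetric]\<close>)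
  have le: "(\<Sum>i<Suc d. 1 / (e i - x)) \<le> \<phi>" using bar unfolding bs .
  have card: "card {..<Suc d} \<ge> 2" using d by simp
  have pos: "e i - x > 0" if "i \<in> {..<Suc d}" for i using ex that by simp
  note ineq = barrier_shift_inequality[OF finite_lessThan card pos le]
  have shift: "e i - x - 1 / \<phi> = e i - x'" for i unfolding x'_def by simp
  have ex': "e i > x'" if "i < Suc d" for i using ineq(1)[of i] that unfolding x'_def by simp
  have evA': "\<And>y. eigenvalue A y \<Longrightarrow> y > x'" using ex' evA by auto
  define B where "B i = mat_delete A i i" for i
  have B: "B i \<in> carrier_mat d d" for i unfolding B_def using mat_delete_carrier[OF A] by simp
  have evB: "y > x'" if "i < Suc d" "eigenvalue (B i) y" for i y
    using mat_delete_eigenvalue_greater[OF A sym evA' that(1)] that(2) unfolding B_def by blast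
  \<comment> \<open>The sign \<open>(-1) ^ d\<close> makes each \<open>q i\<close> positive, since
    all \<open>d\<close> eigenvalues of \<open>B i\<close> exceed \<open>x'\<close>. It cancels in
    the quotients that form the barriers.\<close>
  define q where "q i = (-1) ^ d * poly (char_poly (B i)) x'" for i
  define q' where "q' i = (-1) ^ d * poly (pderiv (char_poly (B i))) x'" for i
  have q: "q i > 0" if i: "i < Suc d" for i
  proof -
    have symB: "transpose_mat (B i) = B i" unfolding B_def by (rule symmetric_mat_delete[OF A sym i])
    obtain f where cpB: "char_poly (B i) = (\<Prod>j<d. [:- f j, 1:])"
      and evf: "\<And>x. eigenvalue (B i) x \<longleftrightarrow> (\<exists>j<d. x = f j)"
      using symmetric_char_poly_factors[OF B symB] by blast
    show ?thesis unfolding q_def cpB by (rule prod_below_roots_sign) (use evf evB[OF i] in auto)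
  qed
  have bB: "barrier (B i) x' = - q' i / q i" for i unfolding barrier_def q_def q'_def by simp
  define P where "P = (-1) ^ Suc d * poly (char_poly A) x'"
  have P: "P > 0" unfolding P_def cp by (rule prod_below_roots_sign) (use ex' in auto)
  define s where "s = (\<Sum>i<Suc d. 1 / (e i - x'))"
  define s2 where "s2 = (\<Sum>i<Suc d. (1 / (e i - x'))\<^sup>2)"
  have ne: "e i \<noteq> x'" if "i \<in> {..<Suc d}" for i using ex'[of i] that by auto
  have sq: "(\<Sum>i<Suc d. q i) = P * s"
  proof -
    \<comment> \<open>The sum over all deletions is the derivative of \<open>char_poly A\<close>.
      The minus sign of the logarithmic derivative is absorbed by the additional factor -1 in
      \<open>P\<close>.\<close>
    have "(\<Sum>i<Suc d. q i) = (-1) ^ d * poly (pderiv (char_poly A)) x'"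
      unfolding q_def B_def pderiv_char_poly[OF A] poly_sum sum_distrib_left ..
    also have "poly (pderiv (char_poly A)) x' = - poly (char_poly A) x' * s"
      unfolding cp s_def by (rule pderiv_prod_linear) (use ne in auto)
    finally show ?thesis unfolding P_def by simp
  qed
  have sq': "(\<Sum>i<Suc d. q' i) = - P * (s\<^sup>2 - s2)"
  proof -
    have "(\<Sum>i<Suc d. q' i) = (-1) ^ d * poly (pderiv (pderiv (char_poly A))) x'"
      unfolding q'_def B_def pderiv_char_poly[OF A] pderiv_sum poly_sum sum_distrib_left ..
    also have "poly (pderiv (pderiv (char_poly A))) x' = poly (char_poly A) x' * (s\<^sup>2 - s2)"
      unfolding cp s_def s2_def by (rule pderiv_prod_linear) (use ne in auto)
    finally show ?thesis unfolding P_def by simp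
  qed
  have key: "s\<^sup>2 - s2 \<le> \<phi> * s" using ineq(2) unfolding shift s_def s2_def .
  \<comment> \<open>The quotient \<open>(s\<^sup>2 - s2) / s\<close> is the mean of the barriers \<open>- q' i / q i\<close> with weights \<open>q i\<close>.\<close>
  have "\<exists>i<Suc d. - q' i \<le> \<phi> * q i"
  proof (rule ccontr)
    assume "\<not> ?thesis"
    hence "(\<Sum>i<Suc d. \<phi> * q i) < (\<Sum>i<Suc d. - q' i)"
      by (intro sum_strict_mono) auto
    hence "P * (\<phi> * s) < P * (s\<^sup>2 - s2)"
      unfolding sum_negf sq' sum_distrib_left[symmetric] sq by (simp add: algebra_simps)
    thus False using key P by simp
  qed
  then obtain i where i: "i < Suc d" "- q' i \<le> \<phi> * q i" by blast
  hence "barrier (B i) x' \<le> \<phi>" unfolding bB using q[OF i(1)] by (simp only: divide_le_eq) simp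
  thus ?thesis using i(1) evB[OF i(1)] unfolding B_def x'_def by blast
qed

text \<open>Indices are listed by a function that need not be monotone, so successive deletions
  amount to composition with \<open>insert_index i\<close>.\<close>

definition principal_mat :: "'a mat \<Rightarrow> nat \<Rightarrow> (nat \<Rightarrow> nat) \<Rightarrow> 'a mat" where
  "principal_mat A d g = mat d d (\<lambda>(i, j). A $$ (g i, g j))"

text \<open>Each of the \<open>k\<close> deletions moves the barrier point up by
  \<open>1 / \<phi>\<close>. The extra 1 in \<open>k + 1\<close> arises at the end: a single summand
  of the final barrier is at most \<open>\<phi>\<close>, so each eigenvalue lies at least
  \<open>1 / \<phi>\<close> above the last point.\<close>

lemma barrier_iterate:
  fixes A :: "real mat"
  assumes "A \<in> carrier_mat (d + k) (d + k)" and "d \<ge> 1" and "transpose_mat A = A"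
    and "\<And>e. eigenvalue A e \<Longrightarrow> e > x" and "barrier A x \<le> \<phi>"
  shows "\<exists>g. inj_on g {..<d} \<and> g ` {..<d} \<subseteq> {..<d + k}
    \<and> (\<forall>e. eigenvalue (principal_mat A d g) e \<longrightarrow> e \<ge> x + (real k + 1) / \<phi>)"
  using assms
proof (induction k arbitrary: A x)
  case 0
  hence A: "A \<in> carrier_mat d d" by simp
  have id: "principal_mat A d (\<lambda>i. i) = A" unfolding principal_mat_def by (rule eq_matI) (use A in auto)
  obtain e where cp: "char_poly A = (\<Prod>i<d. [:- e i, 1:])"
    and evA: "\<And>x. eigenvalue A x \<longleftrightarrow> (\<exists>i<d. x = e i)"
    using symmetric_char_poly_factors[OF A 0(3)] by blast
  have ex: "e i > x" if "i < d" for i using 0(4) evA that by blast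
  have bs: "barrier A x = (\<Sum>i<d. 1 / (e i - x))"
    by (rule barrier_eq_sum[OF cp]) (use ex in \<open>auto simp: less_imp_neq[symmetric]\<close>)
  have "e i \<ge> x + 1 / \<phi>" if i: "i < d" for i
  proof -
    have "1 / (e i - x) \<le> (\<Sum>i<d. 1 / (e i - x))"
      by (rule member_le_sum) (use i ex in \<open>auto simp: less_imp_le\<close>)
    hence "1 / (e i - x) \<le> \<phi>" using 0(5) unfolding bs by linarith
    moreover have "e i - x > 0" using ex[OF i] by simp
    moreover from calculation have "\<phi> > 0" by (smt (verit) divide_pos_pos)
    ultimately show ?thesis by (simp add: field_simps)
  qed
  thus ?case by (intro exI[of _ "\<lambda>i. i"]) (auto simp: id evA)
next
  case (Suc k)
  have A: "A \<in> carrier_mat (Suc (d + k)) (Suc (d + k))" using Suc.prems(1) by simp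
  from barrier_step[OF A _ Suc.prems(3-5)] Suc.prems(2) obtain i where i: "i < Suc (d + k)"
    and ev: "\<And>e. eigenvalue (mat_delete A i i) e \<Longrightarrow> e > x + 1 / \<phi>"
    and bar: "barrier (mat_delete A i i) (x + 1 / \<phi>) \<le> \<phi>" by auto
  have B: "mat_delete A i i \<in> carrier_mat (d + k) (d + k)" using mat_delete_carrier[OF A] by simp
  from Suc.IH[OF B Suc.prems(2) symmetric_mat_delete[OF A Suc.prems(3) i] ev bar]
  obtain g where g: "inj_on g {..<d}" "g ` {..<d} \<subseteq> {..<d + k}"
    and evg: "\<And>e. eigenvalue (principal_mat (mat_delete A i i) d g) e
      \<Longrightarrow> e \<ge> x + 1 / \<phi> + (real k + 1) / \<phi>" by auto
  have eq: "principal_mat (mat_delete A i i) d g = principal_mat A d (insert_index i \<circ> g)"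
    unfolding principal_mat_def
    by (rule eq_matI) (use g(2) in \<open>auto intro!: mat_delete_diagonal_index[OF A i]\<close>)
  have "inj_on (insert_index i \<circ> g) {..<d}"
    by (rule comp_inj_on[OF g(1)]) (rule insert_index_inj_on)
  moreover have "(insert_index i \<circ> g) ` {..<d} \<subseteq> {..<d + Suc k}"
    using g(2) by (auto simp: insert_index_def)
  moreover have "x + 1 / \<phi> + (real k + 1) / \<phi> = x + (real (Suc k) + 1) / \<phi>"
    by (simp add: add_divide_distrib)
  ultimately show ?case using evg unfolding eq by metis
qed

section \<open>The spectrum of complementary Gram matrices\<close>

text \<open>Sylvester's determinant identity. The block matrix \<open>K\<close> is made block
  triangular in two ways, by the factors \<open>X\<close> and \<open>Z\<close>. No division by
  \<open>s\<close> occurs, so \<open>s = 0\<close> is covered.\<close>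

lemma det_gram_commute:
  fixes W :: "real mat"
  assumes W: "W \<in> carrier_mat n m"
  shows "s ^ m * det (s \<cdot>\<^sub>m 1\<^sub>m n - W * transpose_mat W) = s ^ n * det (s \<cdot>\<^sub>m 1\<^sub>m m - transpose_mat W * W)"
proof -
  let ?Wt = "transpose_mat W"
  have Wt: "?Wt \<in> carrier_mat m n" using W by auto
  define K where "K = four_block_mat (s \<cdot>\<^sub>m 1\<^sub>m n) W ?Wt (1\<^sub>m m)"
  define X where "X = four_block_mat (1\<^sub>m n) (- W) (0\<^sub>m m n) (1\<^sub>m m :: real mat)"
  define Z where "Z = four_block_mat (1\<^sub>m n) (0\<^sub>m n m) (- ?Wt) (s \<cdot>\<^sub>m 1\<^sub>m m)"
  have K: "K \<in> carrier_mat (n + m) (n + m)" unfolding K_def using W by auto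
  have X: "X \<in> carrier_mat (n + m) (n + m)" unfolding X_def using W by auto
  have Z: "Z \<in> carrier_mat (n + m) (n + m)" unfolding Z_def using W by auto
  have dX: "det X = 1" unfolding X_def using W
    by (subst det_four_block_mat_lower_left_zero[of _ n _ m]) auto
  have dZ: "det Z = s ^ m" unfolding Z_def using W
    by (subst det_four_block_mat_upper_right_zero[of _ n _ m]) auto
  have XK: "X * K = four_block_mat (s \<cdot>\<^sub>m 1\<^sub>m n - W * ?Wt) (0\<^sub>m n m) ?Wt (1\<^sub>m m)"
  proof -
    have "s \<cdot>\<^sub>m 1\<^sub>m n + - W * ?Wt = s \<cdot>\<^sub>m 1\<^sub>m n - W * ?Wt"
      using W by (intro eq_matI) auto
    moreover have "W + - W = 0\<^sub>m n m" using W by (intro eq_matI) auto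
    ultimately show ?thesis
      unfolding X_def K_def using W
      by (subst mult_four_block_mat[of _ n n _ m _ m _ _ n _ m]) auto
  qed
  have ZK: "Z * K = four_block_mat (s \<cdot>\<^sub>m 1\<^sub>m n) W (0\<^sub>m m n) (s \<cdot>\<^sub>m 1\<^sub>m m - ?Wt * W)"
  proof -
    have "- ?Wt * (s \<cdot>\<^sub>m 1\<^sub>m n) + s \<cdot>\<^sub>m 1\<^sub>m m * ?Wt = 0\<^sub>m m n"
      using W Wt by (simp add: mult_smult_distrib[of _ m n] mult_smult_assoc_mat[of _ m m _ n]) (intro eq_matI; auto)
    moreover have "- ?Wt * W + s \<cdot>\<^sub>m 1\<^sub>m m = s \<cdot>\<^sub>m 1\<^sub>m m - ?Wt * W"
      using W by (intro eq_matI) auto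
    ultimately show ?thesis
      unfolding Z_def K_def using W
      by (subst mult_four_block_mat[of _ n n _ m _ m _ _ n _ m]) auto
  qed
  have dK: "det K = det (s \<cdot>\<^sub>m 1\<^sub>m n - W * ?Wt)"
  proof -
    have "det K = det (X * K)" unfolding det_mult[OF X K] dX by simp
    also have "\<dots> = det (s \<cdot>\<^sub>m 1\<^sub>m n - W * ?Wt)" unfolding XK using W
      by (subst det_four_block_mat_upper_right_zero[of _ n _ m]) auto
    finally show ?thesis .
  qed
  have "s ^ m * det K = det (Z * K)" unfolding det_mult[OF Z K] dZ by simp
  also have "\<dots> = s ^ n * det (s \<cdot>\<^sub>m 1\<^sub>m m - ?Wt * W)" unfolding ZK using W
    by (subst det_four_block_mat_lower_left_zero[of _ n _ m]) auto
  finally show ?thesis unfolding dK .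
qed

lemma poly_char_poly_one_minus:
  fixes A :: "real mat"
  assumes A: "A \<in> carrier_mat n n"
  shows "poly (char_poly (1\<^sub>m n - A)) x = (- 1) ^ n * det ((1 - x) \<cdot>\<^sub>m 1\<^sub>m n - A)"
proof -
  have eq: "- (char_matrix (1\<^sub>m n - A) x) = (- 1) \<cdot>\<^sub>m ((1 - x) \<cdot>\<^sub>m 1\<^sub>m n - A)"
    unfolding char_matrix_def using A by (intro eq_matI) auto
  have "1\<^sub>m n - A \<in> carrier_mat n n" using A by auto
  from char_poly_matrix[OF this, of x] show ?thesis unfolding eq det_smult using A by simp
qed

text \<open>\<open>W W^T\<close> and \<open>W^T W\<close> have the same nonzero eigenvalues with
  multiplicities. Subtraction from the identity sends 0 to 1, so the discrepancy consists of powers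
  of \<open>[:-1, 1:]\<close>.\<close>

lemma char_poly_one_minus_gram:
  fixes W :: "real mat"
  assumes W: "W \<in> carrier_mat n m"
  shows "[:-1, 1:] ^ m * char_poly (1\<^sub>m n - W * transpose_mat W)
    = [:-1, 1:] ^ n * char_poly (1\<^sub>m m - transpose_mat W * W)"
proof -
  have c: "W * transpose_mat W \<in> carrier_mat n n" "transpose_mat W * W \<in> carrier_mat m m"
    using W by auto
  have "poly ([:-1, 1:] ^ m * char_poly (1\<^sub>m n - W * transpose_mat W)) x
    = poly ([:-1, 1:] ^ n * char_poly (1\<^sub>m m - transpose_mat W * W)) x" for x
  proof -
    define s where "s = 1 - x"
    have e: "x - 1 = (-1) * s" unfolding s_def by simp
    have "poly ([:-1, 1:] ^ m * char_poly (1\<^sub>m n - W * transpose_mat W)) x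
      = (-1) ^ m * (-1) ^ n * (s ^ m * det (s \<cdot>\<^sub>m 1\<^sub>m n - W * transpose_mat W))"
      using e by (simp add: poly_char_poly_one_minus[OF c(1)] s_def[symmetric] poly_power power_mult_distrib
          del: mult_minus1 mult_minus_left)
    also have "\<dots> = (-1) ^ m * (-1) ^ n * (s ^ n * det (s \<cdot>\<^sub>m 1\<^sub>m m - transpose_mat W * W))"
      unfolding det_gram_commute[OF W] ..
    also have "\<dots> = poly ([:-1, 1:] ^ n * char_poly (1\<^sub>m m - transpose_mat W * W)) x"
      using e by (simp add: poly_char_poly_one_minus[OF c(2)] s_def[symmetric] poly_power power_mult_distrib
          del: mult_minus1 mult_minus_left)
    finally show ?thesis .
  qed
  thus ?thesis unfolding poly_eq_poly_eq_iff[symmetric] by (rule ext)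
qed

lemma proots_prod_linear:
  fixes e :: "nat \<Rightarrow> real"
  shows "proots (\<Prod>i<n. [:- e i, 1:]) = image_mset e (mset_set {..<n})"
  by (subst proots_prod) (auto simp: sum_unfold_sum_mset)

text \<open>Comparison of root multisets: the \<open>z i\<close> with \<open>n\<close> further ones
  are the \<open>e i\<close> with \<open>m\<close> further ones. A free test function
  \<open>h\<close> makes it unnecessary to match the enumerations; indicators give signs and
  multiplicities, and \<open>inverse\<close> gives the Frobenius norm. The difference is taken in
  the reals because \<open>m < n\<close> is possible.\<close>

lemma gram_spectrum_sum:
  fixes W :: "real mat" and h :: "real \<Rightarrow> real"
  assumes W: "W \<in> carrier_mat n m"
    and e: "char_poly (1\<^sub>m n - W * transpose_mat W) = (\<Prod>i<n. [:- e i, 1:])"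
    and z: "char_poly (1\<^sub>m m - transpose_mat W * W) = (\<Prod>i<m. [:- z i, 1:])"
  shows "(\<Sum>i<m. h (z i)) = (\<Sum>i<n. h (e i)) + (real m - real n) * h 1"
proof -
  have nz: "(\<Prod>i<k. [:- f i, 1:]) \<noteq> 0" for k and f :: "nat \<Rightarrow> real" by auto
  have "proots ([:-1, 1:] ^ m * (\<Prod>i<n. [:- e i, 1:])) = proots ([:-1, 1:] ^ n * (\<Prod>i<m. [:- z i, 1:]))"
    using char_poly_one_minus_gram[OF W] unfolding e z by simp
  hence "repeat_mset m {#1#} + image_mset e (mset_set {..<n}) = repeat_mset n {#1#} + image_mset z (mset_set {..<m})"
    by (simp add: proots_mult nz proots_power proots_prod_linear)
  hence "(\<Sum>x\<in>#repeat_mset m {#1#} + image_mset e (mset_set {..<n}). h x)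
      = (\<Sum>x\<in>#repeat_mset n {#1#} + image_mset z (mset_set {..<m}). h x)" by simp
  moreover have "(\<Sum>x\<in>#repeat_mset k {#1#}. h x) = real k * h 1" for k
    by (induction k) (auto simp: algebra_simps)
  ultimately show ?thesis
    by (simp add: image_mset.compositionality comp_def sum_unfold_sum_mset[symmetric] algebra_simps)
qed

text \<open>Jensen's inequality for \<open>w / (1 + t w)\<close> with \<open>w = 1 / z\<close>, proved with the tangent at \<open>w = 1 / c\<close>.
  The convention \<open>inverse 0 = 0\<close> restricts the sum \<open>H\<close> to the nonzero \<open>z i\<close>.\<close>

lemma sum_inverse_shift_le:
  fixes z :: "nat \<Rightarrow> real"
  assumes z: "\<And>i. i < m \<Longrightarrow> z i \<ge> 0" and a: "card {i. i < m \<and> z i = 0} = a"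
    and H: "(\<Sum>i<m. inverse (z i)) = H" and am: "a < m" and t: "t > 0"
  defines "c \<equiv> (real m - real a) / H"
  shows "H > 0" and "(\<Sum>i<m. 1 / (z i + t)) \<le> real a / t + (real m - real a) / (c + t)"
proof -
  define Z where "Z = {i. i < m \<and> z i = 0}"
  define N where "N = {i. i < m \<and> z i \<noteq> 0}"
  have fin: "finite Z" "finite N" "Z \<inter> N = {}" and un: "{..<m} = Z \<union> N" unfolding Z_def N_def by auto
  have split: "(\<Sum>i<m. f i) = (\<Sum>i\<in>Z. f i) + (\<Sum>i\<in>N. f i)" for f :: "nat \<Rightarrow> real"
    unfolding un by (rule sum.union_disjoint[OF fin])
  have cZ: "card Z = a" using a unfolding Z_def .
  have cN: "real (card N) = real m - real a"
    using card_Un_disjoint[OF fin] cZ unfolding un[symmetric] by simp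
  have N0: "N \<noteq> {}" using cN am by auto
  have zN: "z i > 0" if "i \<in> N" for i using that z[of i] unfolding N_def by auto
  have HN: "H = (\<Sum>i\<in>N. 1 / z i)" unfolding H[symmetric] split by (simp add: Z_def inverse_eq_divide)
  show Hp: "H > 0" unfolding HN by (rule sum_pos) (use fin N0 zN in auto)
  have c: "c > 0" unfolding c_def using Hp am by simp
  have tangent: "1 / (y + t) \<le> 1 / (c + t) + (c / (c + t))\<^sup>2 * (1 / y - 1 / c)" if y: "y > 0" for y
  proof -
    have "1 / (c + t) + (c / (c + t))\<^sup>2 * (1 / y - 1 / c) - 1 / (y + t)
        = t * (y - c)\<^sup>2 / ((c + t)\<^sup>2 * (y + t) * y)"
    proof -
      have n: "c + t \<noteq> 0" "y + t \<noteq> 0" "y \<noteq> 0" "c \<noteq> 0" using y c t by auto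
      have "(1 / (c + t) + (c / (c + t))\<^sup>2 * (1 / y - 1 / c) - 1 / (y + t)) * ((c + t)\<^sup>2 * (y + t) * y)
        = (c + t) * (1 / (c + t) * (c + t)) * (y + t) * y
          + (c / (c + t) * (c + t))\<^sup>2 * (y * (1 / y) - y * (1 / c)) * (y + t)
          - (1 / (y + t) * (y + t)) * (c + t)\<^sup>2 * y"
        by (simp only: power2_eq_square algebra_simps)
      also have "\<dots> = (c + t) * (y + t) * y + c * (c - y) * (y + t) - (c + t)\<^sup>2 * y"
        using n by (simp add: power2_eq_square right_diff_distrib)
      also have "\<dots> = t * (y - c)\<^sup>2" by (simp add: power2_eq_square algebra_simps)
      finally show ?thesis using n by (simp add: eq_divide_eq)
    qed
    also have "\<dots> \<ge> 0" using y c t by simp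
    finally show ?thesis by simp
  qed
  have "(\<Sum>i\<in>N. 1 / (z i + t)) \<le> (\<Sum>i\<in>N. 1 / (c + t) + (c / (c + t))\<^sup>2 * (1 / z i - 1 / c))"
    by (rule sum_mono) (use tangent zN in auto)
  also have "\<dots> = real (card N) / (c + t) + (c / (c + t))\<^sup>2 * (H - real (card N) / c)"
    unfolding HN by (simp add: sum.distrib sum_distrib_left[symmetric] sum_subtractf)
  \<comment> \<open>\<open>1 / c\<close> is the mean of the \<open>1 / z i\<close> over
    \<open>N\<close>, so the linear terms of the tangents cancel.\<close>
  also have "H - real (card N) / c = 0" unfolding c_def cN using Hp am by simp
  finally have "(\<Sum>i\<in>N. 1 / (z i + t)) \<le> (real m - real a) / (c + t)" unfolding cN by simp
  moreover have "(\<Sum>i\<in>Z. 1 / (z i + t)) = real a / t" using cZ by (simp add: Z_def)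
  ultimately show "(\<Sum>i<m. 1 / (z i + t)) \<le> real a / t + (real m - real a) / (c + t)"
    unfolding split by simp
qed

section \<open>Pseudoinverse and rank\<close>

text \<open>The diagonal of \<open>N N^T\<close> consists of the squared norms of the rows of
  \<open>N\<close>.\<close>

lemma gram_zero_imp_zero:
  fixes N :: "real mat"
  assumes N: "N \<in> carrier_mat n l" and z: "N * transpose_mat N = 0\<^sub>m n n"
  shows "N = 0\<^sub>m n l"
proof (rule eq_matI)
  fix i j assume "i < dim_row (0\<^sub>m n l)" "j < dim_col (0\<^sub>m n l)"
  hence ij: "i < n" "j < l" by auto
  have "(\<Sum>k<l. (N $$ (i,k))\<^sup>2) = (N * transpose_mat N) $$ (i,i)"
    using ij N by (auto simp: scalar_prod_def atLeast0LessThan power2_eq_square)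
  hence "(\<Sum>k<l. (N $$ (i,k))\<^sup>2) = 0" unfolding z using ij by simp
  hence "(N $$ (i,j))\<^sup>2 = 0" using ij by (subst (asm) sum_nonneg_eq_0_iff) auto
  thus "N $$ (i,j) = 0\<^sub>m n l $$ (i,j)" using ij by simp
qed (use N in auto)

text \<open>\<open>A * X\<close> and \<open>A * Y\<close> are symmetric, and each is absorbed by the
  other in a product, so transposing the product identifies them. The same holds for
  \<open>X * A\<close> and \<open>Y * A\<close>, and then X = XAX = XAY = YAY = Y.\<close>

lemma is_pseudoinverse_unique:
  assumes X: "is_pseudoinverse A X" and Y: "is_pseudoinverse A Y"
  shows "X = Y"
proof -
  have dX: "dim_row X = dim_col A" "dim_col X = dim_row A" and dY: "dim_row Y = dim_col A" "dim_col Y = dim_row A"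
    and X1: "A * X * A = A" and X2: "X * A * X = X" and X3: "transpose_mat (A * X) = A * X"
    and X4: "transpose_mat (X * A) = X * A"
    and Y1: "A * Y * A = A" and Y2: "Y * A * Y = Y" and Y3: "transpose_mat (A * Y) = A * Y"
    and Y4: "transpose_mat (Y * A) = Y * A"
    using X Y unfolding is_pseudoinverse_def by auto
  note d = dX dY
  have "A * X = (A * Y) * (A * X)" using Y1 d by (simp add: assoc_mult_mat_dim[symmetric])
  hence "A * X = transpose_mat ((A * Y) * (A * X))" using X3 by simp
  also have "\<dots> = (A * X) * (A * Y)" using d by (simp add: transpose_mult_dim X3 Y3)
  also have "\<dots> = A * Y" using X1 d by (simp add: assoc_mult_mat_dim[symmetric])
  finally have l: "A * X = A * Y" .
  have "X * A = (X * A) * (Y * A)" using Y1 d by (simp add: assoc_mult_mat_dim)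
  hence "X * A = transpose_mat ((X * A) * (Y * A))" using X4 by simp
  also have "\<dots> = (Y * A) * (X * A)" using d by (simp add: transpose_mult_dim X4 Y4)
  also have "\<dots> = Y * A" using X1 d by (simp add: assoc_mult_mat_dim)
  finally have r: "X * A = Y * A" .
  have "X = X * A * X" using X2 by simp
  also have "\<dots> = X * (A * Y)" using d l by (simp add: assoc_mult_mat_dim)
  also have "\<dots> = Y * A * Y" using d r by (simp add: assoc_mult_mat_dim[symmetric])
  finally show ?thesis using Y2 by simp
qed

lemma pseudoinverse_eqI: "is_pseudoinverse A X \<Longrightarrow> pseudoinverse A = X"
  unfolding pseudoinverse_def using is_pseudoinverse_unique by blast

text \<open>\<open>U\<close> contains left singular vectors of \<open>M\<close>, and
  \<open>e\<close> the squared singular values together with zeros. The pseudoinverse, its norm and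
  the rank are read off from these data.\<close>

locale gram_diagonalization =
  fixes M U :: "real mat" and n l :: nat and e :: "nat \<Rightarrow> real"
  assumes M: "M \<in> carrier_mat n l" and U: "U \<in> carrier_mat n n"
    and U1: "transpose_mat U * U = 1\<^sub>m n"
    and MU: "M * transpose_mat M = U * mat_diag n e * transpose_mat U"
begin

text \<open>The functional calculus of \<open>M M^T\<close>: for \<open>f = h \<circ> e\<close> this
  is \<open>h\<close> applied to that matrix.\<close>

definition "conj_diag f = U * mat_diag n f * transpose_mat U"

lemma dim_M: "dim_row M = n" "dim_col M = l" "dim_row U = n" "dim_col U = n"
  using M U by auto

lemma conj_diag_carrier [simp]: "conj_diag f \<in> carrier_mat n n"
  unfolding conj_diag_def using U by auto

lemma dim_conj_diag [simp]: "dim_row (conj_diag f) = n" "dim_col (conj_diag f) = n"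
  using carrier_matD[OF conj_diag_carrier] by simp_all

lemma transpose_conj_diag [simp]: "transpose_mat (conj_diag f) = conj_diag f"
proof -
  have "transpose_mat (mat_diag n f) = mat_diag n f"
    by (rule eq_matI) (auto simp: mat_diag_def)
  thus ?thesis unfolding conj_diag_def using dim_M by (simp add: transpose_mult_dim assoc_mult_mat_dim)
qed

lemma conj_diag_mult: "conj_diag f * conj_diag g = conj_diag (\<lambda>i. f i * g i)"
proof -
  have "conj_diag f * conj_diag g = U * (mat_diag n f * (transpose_mat U * U * (mat_diag n g * transpose_mat U)))"
    unfolding conj_diag_def using dim_M by (simp add: assoc_mult_mat_dim)
  also have "\<dots> = U * (mat_diag n f * mat_diag n g) * transpose_mat U"
    unfolding U1 using dim_M U by (simp add: assoc_mult_mat_dim del: mat_diag_diag)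
  finally show ?thesis unfolding conj_diag_def by simp
qed

text \<open>Because \<open>inverse 0 = 0\<close>, the scalar inverse satisfies the Penrose
  identities at zero eigenvalues too.\<close>

lemma inverse_cancel:
  "(\<lambda>i. e i * inverse (e i) * e i) = e" "(\<lambda>i. e i * (e i * inverse (e i))) = e"
  "(\<lambda>i. inverse (e i) * (e i * inverse (e i))) = (\<lambda>i. inverse (e i))"
proof -
  have "x * inverse x * x = x" "x * (x * inverse x) = x" "inverse x * (x * inverse x) = inverse x"
    for x :: real by (cases "x = 0"; simp)+
  thus "(\<lambda>i. e i * inverse (e i) * e i) = e" "(\<lambda>i. e i * (e i * inverse (e i))) = e"
    "(\<lambda>i. inverse (e i) * (e i * inverse (e i))) = (\<lambda>i. inverse (e i))" by auto
qed

lemma M_gram: "M * transpose_mat M = conj_diag e" unfolding MU conj_diag_def ..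

text \<open>The pseudoinverse of \<open>M M^T\<close>, again by the convention
  \<open>inverse 0 = 0\<close>.\<close>

definition "ginv = conj_diag (\<lambda>i. inverse (e i))"

text \<open>The left factor \<open>Q\<close> projects orthogonally onto the span of the eigenvectors
  with nonzero eigenvalue. It fixes \<open>M M^T\<close>, so the defect \<open>N = Q * M - M\<close>
  satisfies \<open>N N^T = 0\<close> and vanishes.\<close>

lemma range_projection: "conj_diag (\<lambda>i. e i * inverse (e i)) * M = M"
proof -
  define Q where "Q = conj_diag (\<lambda>i. e i * inverse (e i))"
  have Q: "Q \<in> carrier_mat n n" unfolding Q_def by simp
  have Qe: "Q * conj_diag e = conj_diag e" "conj_diag e * Q = conj_diag e" unfolding Q_def conj_diag_mult inverse_cancel by simp_all
  have QQ: "Q * (conj_diag e * Q) = conj_diag e" using Qe by simp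
  define N where "N = Q * M - M"
  have N: "N \<in> carrier_mat n l" unfolding N_def using M by auto
  have QM: "Q * M \<in> carrier_mat n l" using Q M by auto
  have Mt: "transpose_mat M \<in> carrier_mat l n" using M by auto
  have Nt: "transpose_mat N = transpose_mat M * Q - transpose_mat M"
  proof -
    have "transpose_mat N = transpose_mat (Q * M) - transpose_mat M"
      unfolding N_def by (rule transpose_minus[OF QM M])
    also have "transpose_mat (Q * M) = transpose_mat M * Q"
      unfolding Q_def using dim_M by (simp add: transpose_mult_dim)
    finally show ?thesis .
  qed
  have MtQ: "transpose_mat M * Q \<in> carrier_mat l n" using Mt Q by auto
  have "N * transpose_mat N = (Q * M) * (transpose_mat M * Q - transpose_mat M) - M * (transpose_mat M * Q - transpose_mat M)"
    unfolding Nt unfolding N_def by (rule minus_mult_distrib_mat[OF QM M minus_carrier_mat[OF Mt]])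
  also have "(Q * M) * (transpose_mat M * Q - transpose_mat M) = (Q * M) * (transpose_mat M * Q) - (Q * M) * transpose_mat M"
    by (rule mult_minus_distrib_mat[OF QM MtQ Mt])
  also have "M * (transpose_mat M * Q - transpose_mat M) = M * (transpose_mat M * Q) - M * transpose_mat M"
    by (rule mult_minus_distrib_mat[OF M MtQ Mt])
  also have "(Q * M) * (transpose_mat M * Q) = Q * ((M * transpose_mat M) * Q)"
    using dim_M Q by (simp add: assoc_mult_mat_dim)
  also have "(Q * M) * transpose_mat M = Q * (M * transpose_mat M)"
    using dim_M Q by (simp add: assoc_mult_mat_dim)
  also have "M * (transpose_mat M * Q) = (M * transpose_mat M) * Q"
    using dim_M Q by (simp add: assoc_mult_mat_dim)
  also have "Q * ((M * transpose_mat M) * Q) - Q * (M * transpose_mat M)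
      - ((M * transpose_mat M) * Q - M * transpose_mat M) = 0\<^sub>m n n"
    unfolding M_gram QQ Qe by (rule eq_matI) auto
  finally have "N = 0\<^sub>m n l" using gram_zero_imp_zero[OF N] by simp
  hence "Q * M - M = 0\<^sub>m n l" unfolding N_def .
  hence z: "(Q * M - M) $$ (i,j) = 0" if "i < n" "j < l" for i j using that by simp
  have "Q * M = M"
  proof (rule eq_matI)
    fix i j assume "i < dim_row M" "j < dim_col M"
    thus "(Q * M) $$ (i,j) = M $$ (i,j)" using z[of i j] M by (simp del: index_mult_mat)
  qed (simp_all only: carrier_matD[OF QM] carrier_matD[OF M])
  thus ?thesis unfolding Q_def .
qed

lemma gram_ginv: "M * (transpose_mat M * ginv) = conj_diag (\<lambda>i. e i * inverse (e i))"
proof -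
  have "M * (transpose_mat M * ginv) = (M * transpose_mat M) * ginv"
    using dim_M by (simp add: assoc_mult_mat_dim ginv_def)
  thus ?thesis unfolding M_gram ginv_def conj_diag_mult .
qed

text \<open>By uniqueness it suffices to verify the Penrose conditions. The first one is the range
  projection; the others follow from symmetry and the functional calculus.\<close>

lemma pseudoinverse_eq: "pseudoinverse M = transpose_mat M * ginv"
proof (rule pseudoinverse_eqI)
  let ?X = "transpose_mat M * ginv"
  have d: "dim_row ginv = n" "dim_col ginv = n" unfolding ginv_def by simp_all
  have "?X \<in> carrier_mat (dim_col M) (dim_row M)" using dim_M d by auto
  moreover have "M * ?X * M = M" unfolding gram_ginv by (rule range_projection)
  moreover have "?X * M * ?X = ?X"
  proof -
    have "?X * M * ?X = transpose_mat M * (ginv * (M * ?X))"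
      using dim_M d by (simp add: assoc_mult_mat_dim)
    also have "ginv * (M * ?X) = ginv"
      unfolding gram_ginv unfolding ginv_def conj_diag_mult inverse_cancel ..
    finally show ?thesis .
  qed
  moreover have "transpose_mat (M * ?X) = M * ?X" unfolding gram_ginv by simp
  moreover have "transpose_mat (?X * M) = ?X * M"
    unfolding ginv_def using dim_M by (simp add: transpose_mult_dim assoc_mult_mat_dim)
  ultimately show "is_pseudoinverse M ?X" unfolding is_pseudoinverse_def by blast
qed

lemma conj_diag_diagonal: "j < n \<Longrightarrow> conj_diag f $$ (j,j) = (\<Sum>i<n. f i * (U $$ (j,i))\<^sup>2)"
  unfolding conj_diag_def mat_diag_mult_right[OF U] using U
  by (auto simp: scalar_prod_def atLeast0LessThan power2_eq_square intro!: sum.cong)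

text \<open>The squared norm is the trace of \<open>X^T X = ginv\<close>, and the columns of
  \<open>U\<close> have norm 1. Zero eigenvalues contribute nothing.\<close>

lemma frobenius_norm_pseudoinverse: "(frobenius_norm (pseudoinverse M))\<^sup>2 = (\<Sum>i<n. inverse (e i))"
proof -
  define X where "X = transpose_mat M * ginv"
  have X: "X \<in> carrier_mat l n" unfolding X_def ginv_def using M by auto
  have XX: "transpose_mat X * X = ginv"
  proof -
    have "transpose_mat X * X = ginv * (M * (transpose_mat M * ginv))"
      unfolding X_def using dim_M by (simp add: transpose_mult_dim assoc_mult_mat_dim ginv_def)
    also have "\<dots> = ginv"
      unfolding gram_ginv unfolding ginv_def conj_diag_mult inverse_cancel ..
    finally show ?thesis .
  qed
  have "(frobenius_norm X)\<^sup>2 = (\<Sum>i<l. \<Sum>j<n. (X $$ (i,j))\<^sup>2)"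
    unfolding frobenius_norm_def using X by (subst real_sqrt_pow2) (auto intro!: sum_nonneg)
  also have "\<dots> = (\<Sum>j<n. \<Sum>i<l. (X $$ (i,j))\<^sup>2)" by (rule sum.swap)
  also have "\<dots> = (\<Sum>j<n. (transpose_mat X * X) $$ (j,j))"
    using X by (intro sum.cong) (auto simp: scalar_prod_def atLeast0LessThan power2_eq_square)
  also have "\<dots> = (\<Sum>j<n. \<Sum>i<n. inverse (e i) * (U $$ (j,i))\<^sup>2)"
    unfolding XX ginv_def by (intro sum.cong) (auto simp: conj_diag_diagonal)
  also have "\<dots> = (\<Sum>i<n. \<Sum>j<n. inverse (e i) * (U $$ (j,i))\<^sup>2)" by (rule sum.swap)
  also have "\<dots> = (\<Sum>i<n. inverse (e i))"
  proof (rule sum.cong[OF refl])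
    fix i assume "i \<in> {..<n}"
    hence i: "i < n" by simp
    have "(\<Sum>j<n. (U $$ (j,i))\<^sup>2) = (transpose_mat U * U) $$ (i,i)"
      using i U by (auto simp: scalar_prod_def atLeast0LessThan power2_eq_square)
    thus "(\<Sum>j<n. inverse (e i) * (U $$ (j,i))\<^sup>2) = inverse (e i)"
      unfolding U1 using i by (simp add: sum_distrib_left[symmetric])
  qed
  finally show ?thesis unfolding X_def pseudoinverse_eq .
qed

text \<open>The columns of \<open>U\<close> with nonzero eigenvalue form a matrix \<open>V\<close>
  with orthonormal columns, and \<open>V V^T\<close> is the range projection. Hence \<open>M\<close>
  and \<open>V\<close> have the same column space.\<close>

lemma rank_eq: "vec_space.rank n M = card {i. i < n \<and> e i \<noteq> 0}"
proof -
  interpret vec_space "TYPE(real)" n .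
  define I where "I = {i. i < n \<and> e i \<noteq> 0}"
  define d where "d = card I"
  have finI: "finite I" unfolding I_def by simp
  obtain f where f: "bij_betw f {0..<d} I" using ex_bij_betw_nat_finite[OF finI] unfolding d_def by blast
  have fI: "f j \<in> I" "f j < n" if "j < d" for j
    using bij_betwE[OF f] that unfolding I_def by auto
  have finj: "f i = f j \<longleftrightarrow> i = j" if "i < d" "j < d" for i j
    using bij_betw_imp_inj_on[OF f] that unfolding inj_on_def by auto
  define V where "V = mat n d (\<lambda>(i,j). U $$ (i, f j))"
  have V: "V \<in> carrier_mat n d" unfolding V_def by auto
  have VtV: "transpose_mat V * V = 1\<^sub>m d"
  proof (rule eq_matI)
    fix i j assume "i < dim_row (1\<^sub>m d :: real mat)" "j < dim_col (1\<^sub>m d :: real mat)"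
    hence ij: "i < d" "j < d" by auto
    have "(transpose_mat V * V) $$ (i,j) = (transpose_mat U * U) $$ (f i, f j)"
      using ij U fI[OF ij(1)] fI[OF ij(2)] by (auto simp: V_def scalar_prod_def)
    thus "(transpose_mat V * V) $$ (i,j) = 1\<^sub>m d $$ (i,j)"
      unfolding U1 using ij fI[OF ij(1)] fI[OF ij(2)] finj[OF ij] by auto
  qed (use V in auto)
  have VVt: "V * transpose_mat V = conj_diag (\<lambda>i. e i * inverse (e i))"
  proof (rule eq_matI)
    fix i j assume "i < dim_row (conj_diag (\<lambda>i. e i * inverse (e i)))" "j < dim_col (conj_diag (\<lambda>i. e i * inverse (e i)))"
    hence ij: "i < n" "j < n" by auto
    have "(V * transpose_mat V) $$ (i,j) = (\<Sum>k\<in>{0..<d}. U $$ (i, f k) * U $$ (j, f k))"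
      using ij by (auto simp: V_def scalar_prod_def)
    also have "\<dots> = (\<Sum>p\<in>I. U $$ (i, p) * U $$ (j, p))"
      by (rule sum.reindex_bij_betw[OF f])
    also have "\<dots> = (\<Sum>p<n. U $$ (i, p) * (e p * inverse (e p)) * U $$ (j, p))"
      by (rule sum.mono_neutral_cong_left) (auto simp: I_def)
    also have "\<dots> = conj_diag (\<lambda>i. e i * inverse (e i)) $$ (i,j)"
      unfolding conj_diag_def mat_diag_mult_right[OF U] using ij U
      by (simp add: scalar_prod_def atLeast0LessThan)
    finally show "(V * transpose_mat V) $$ (i,j) = conj_diag (\<lambda>i. e i * inverse (e i)) $$ (i,j)" .
  qed (use V in auto)
  have Vinj: "x = 0\<^sub>v d" if x: "x \<in> carrier_vec d" "V *\<^sub>v x = 0\<^sub>v n" for x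
  proof -
    have "x = (transpose_mat V * V) *\<^sub>v x" unfolding VtV using x by simp
    also have "\<dots> = transpose_mat V *\<^sub>v (V *\<^sub>v x)"
      by (rule assoc_mult_mat_vec[of _ d n _ d]) (use V x in auto)
    also have "\<dots> = 0\<^sub>v d" unfolding x(2) using V by auto
    finally show ?thesis .
  qed
  have dist: "distinct (cols V)"
    unfolding distinct_conv_nth
  proof (intro allI impI)
    fix i j assume ij: "i < length (cols V)" "j < length (cols V)" "i \<noteq> j"
    hence ij': "i < d" "j < d" using V by auto
    show "cols V ! i \<noteq> cols V ! j"
    proof
      assume "cols V ! i = cols V ! j"
      hence "col V i = col V j" using ij' V by auto
      hence "(transpose_mat V * V) $$ (i,i) = (transpose_mat V * V) $$ (i,j)" using ij' V by auto
      thus False unfolding VtV using ij' ij(3) by auto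
    qed
  qed
  have "lin_indpt (set (cols V))" using lin_depE[OF V _ dist] Vinj by blast
  hence rV: "rank V = d" by (rule lin_indpt_full_rank[OF V dist])
  \<comment> \<open>One inclusion uses \<open>V V^T M = M\<close>, the other
    \<open>M X V = V\<close> for the pseudoinverse \<open>X\<close>.\<close>
  have "col_space M = col_space V"
  proof (rule equalityI; rule subsetI)
    fix y assume "y \<in> col_space M"
    then obtain x where x: "x \<in> carrier_vec l" and y: "y = M *\<^sub>v x" "y \<in> carrier_vec n"
      unfolding col_space_eq[OF M] using M by auto
    have "y = (V * transpose_mat V) * M *\<^sub>v x" unfolding VVt range_projection y ..
    also have "\<dots> = (V * transpose_mat V) *\<^sub>v (M *\<^sub>v x)"
      by (rule assoc_mult_mat_vec[of _ n n _ l]) (use V M x in auto)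
    also have "\<dots> = V *\<^sub>v (transpose_mat V *\<^sub>v (M *\<^sub>v x))"
      by (rule assoc_mult_mat_vec[of _ n d _ n]) (use V M x in auto)
    finally show "y \<in> col_space V" unfolding col_space_eq[OF V] using V M x y(2) by auto
  next
    fix y assume "y \<in> col_space V"
    then obtain x where x: "x \<in> carrier_vec d" and y: "y = V *\<^sub>v x" "y \<in> carrier_vec n"
      unfolding col_space_eq[OF V] using V by auto
    define X where "X = transpose_mat M * ginv"
    have X: "X \<in> carrier_mat l n" unfolding X_def ginv_def using M by auto
    have "y = V * (transpose_mat V * V) *\<^sub>v x" unfolding VtV y using V by simp
    also have "V * (transpose_mat V * V) = M * X * V"
      using VVt gram_ginv V by (simp add: X_def[symmetric] assoc_mult_mat_dim[symmetric])
    also have "M * X * V *\<^sub>v x = M * X *\<^sub>v (V *\<^sub>v x)"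
      by (rule assoc_mult_mat_vec[of _ n n _ d]) (use V M X x in auto)
    also have "\<dots> = M *\<^sub>v (X *\<^sub>v (V *\<^sub>v x))"
      by (rule assoc_mult_mat_vec[of _ n l _ n]) (use V M X x in auto)
    finally show "y \<in> col_space M" unfolding col_space_eq[OF M] using V M X x y(2) by auto
  qed
  hence "rank M = rank V" unfolding rank_def col_space_def by simp
  thus ?thesis unfolding rV d_def I_def .
qed

end

section \<open>The optimal starting point\<close>

text \<open>The substitution of \<open>s\<close> for \<open>t\<close> is chosen such that
  \<open>a * (c + t) + b * t = c * s\<close>. The value to be maximised then involves only a
  constant, \<open>s\<close> and \<open>1 / s\<close>. In the application \<open>K\<close> is
  \<open>k + 1\<close>.\<close>

lemma optimal_shift_value:
  fixes a b c K s :: real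
  assumes a: "a \<ge> 0" and b: "b > 0" and c: "c > 0" and s: "s > a"
  defines "t \<equiv> c * (s - a) / (a + b)"
  shows "- t + K / (a / t + b / (c + t))
    = c / (a + b)\<^sup>2 * (K * b + a * (a + b - K) - (a + b - K) * s - a * K * b / s)"
proof -
  define m where "m = a + b"
  have m: "m > 0" unfolding m_def using a b by simp
  have s0: "s > 0" using a s by simp
  have t: "t > 0" unfolding t_def using c s a b by simp
  have ct: "c + t = c * (s + b) / m" unfolding t_def m_def using a b by (simp add: field_simps)
  have sb: "s + b > 0" using s0 b by simp
  have "a * (c + t) + b * t = c * s"
    unfolding ct unfolding t_def m_def[symmetric] using m
    by (simp add: field_simps) (simp add: m_def algebra_simps)
  moreover have "a / t + b / (c + t) = (a * (c + t) + b * t) / (t * (c + t))"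
    using t c by (simp add: add_frac_eq mult.commute)
  ultimately have "K / (a / t + b / (c + t)) = K * (t * (c + t)) / (c * s)" by simp
  also have "\<dots> = c / m\<^sup>2 * (K * ((s - a) * (s + b) / s))"
    unfolding ct unfolding t_def m_def[symmetric] using m c s0
    by (simp add: power2_eq_square divide_simps)
  also have "(s - a) * (s + b) / s = s + b - a - a * b / s"
    using s0 by (simp add: field_simps)
  finally have 1: "K / (a / t + b / (c + t)) = c / m\<^sup>2 * (K * (s + b - a - a * b / s))" .
  have "- t = c / m\<^sup>2 * (- m * (s - a))"
    unfolding t_def m_def[symmetric] using m by (simp add: power2_eq_square)
  hence "- t + K / (a / t + b / (c + t)) = c / m\<^sup>2 * (- m * (s - a) + K * (s + b - a - a * b / s))"
    unfolding 1 by (simp only: distrib_left)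
  also have "- m * (s - a) + K * (s + b - a - a * b / s)
      = K * b + a * (m - K) - (m - K) * s - a * K * b / s"
    by (simp add: algebra_simps)
  finally show ?thesis unfolding m_def .
qed

text \<open>With \<open>q = a + b - K\<close>, the sum \<open>q * s + a * K * b / s\<close> has to
  be close to its infimum \<open>2 * r\<close>. If \<open>a\<close> and \<open>q\<close> are
  positive, the infimum is attained where both summands agree. If \<open>a = 0\<close>, small
  \<open>s\<close> approach it, and if \<open>q = 0\<close>, large \<open>s\<close> do; hence the
  strict bound on \<open>\<mu>\<close>.\<close>

lemma optimal_shift_exists:
  fixes a b c K \<mu> :: real
  assumes a: "a \<ge> 0" and b: "b > 0" and c: "c > 0" and aK: "a < K" and Km: "K \<le> a + b"
    and \<mu>: "\<mu> < c * (sqrt (K * b) - sqrt (a * (a + b - K)))\<^sup>2 / (a + b)\<^sup>2"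
  shows "\<exists>t>0. \<mu> < - t + K / (a / t + b / (c + t))"
proof -
  define q where "q = a + b - K"
  define r where "r = sqrt (K * b) * sqrt (a * q)"
  have q: "q \<ge> 0" unfolding q_def using Km by simp
  have K: "K > 0" using a aK by simp
  have sq: "(sqrt (K * b) - sqrt (a * q))\<^sup>2 = K * b + a * q - 2 * r"
    unfolding r_def power2_diff using K b a q by simp
  have cm: "c / (a + b)\<^sup>2 > 0" using a b c by simp
  \<comment> \<open>The slack in the assumption on \<open>\<mu>\<close>, scaled by
    \<open>(a + b)\<^sup>2 / c\<close>.\<close>
  define \<epsilon> where "\<epsilon> = K * b + a * q - 2 * r - \<mu> * ((a + b)\<^sup>2 / c)"
  have "\<mu> * ((a + b)\<^sup>2 / c) < (c * (K * b + a * q - 2 * r) / (a + b)\<^sup>2) * ((a + b)\<^sup>2 / c)"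
    by (rule mult_strict_right_mono) (use \<mu> a b c in \<open>auto simp: q_def[symmetric] sq\<close>)
  hence \<epsilon>: "\<epsilon> > 0" unfolding \<epsilon>_def using a b c by simp
  have "\<exists>s>a. q * s + a * K * b / s < 2 * r + \<epsilon>"
  proof -
    consider "a = 0" | "q = 0" "a > 0" | "q > 0" "a > 0" using a q by linarith
    thus ?thesis
    proof cases
      case 1
      have "q * (\<epsilon> / (q + 1)) = \<epsilon> * (q / (q + 1))" by simp
      also have "\<dots> < \<epsilon> * 1" using \<epsilon> q by (intro mult_strict_left_mono) auto
      finally have "q * (\<epsilon> / (q + 1)) < \<epsilon>" by simp
      moreover have "\<epsilon> / (q + 1) > 0" using \<epsilon> q by simp
      ultimately show ?thesis using 1 by (intro exI[of _ "\<epsilon> / (q + 1)"]) (simp add: r_def)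
    next
      case 2
      define s where "s = a + 1 + a * K * b / \<epsilon>"
      have p: "a * K * b > 0" using 2 K b by simp
      have s: "s > a" "s > 0" unfolding s_def using p \<epsilon> 2 by (auto intro!: add_pos_pos add_strict_increasing simp: add.assoc)
      have "a * K * b < s * \<epsilon>" unfolding s_def using p \<epsilon> 2 by (simp add: distrib_right add_pos_pos)
      hence "a * K * b / s < \<epsilon>" using s by (simp add: divide_less_eq mult.commute)
      thus ?thesis using 2 s by (intro exI[of _ s]) (simp add: r_def)
    next
      case 3
      define s where "s = sqrt (a * K * b / q)"
      \<comment> \<open>The minimiser must exceed \<open>a\<close> for \<open>t\<close> to be
        positive, and this is where \<open>a < K\<close> enters.\<close>
      have "K * b - a * q = (a + b) * (K - a)" unfolding q_def by (simp add: algebra_simps)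
      also have "\<dots> > 0" using a b aK by simp
      finally have "a * q < K * b" by simp
      hence "a * (a * q) < a * (K * b)" using 3 by simp
      hence "a\<^sup>2 < a * K * b / q" using 3 by (simp add: less_divide_eq power2_eq_square mult.assoc)
      hence s: "s > a" unfolding s_def by (rule real_less_rsqrt)
      have s0: "s > 0" using s a by simp
      have ss: "s * s = a * K * b / q" unfolding s_def using 3 K b by simp
      have r: "r = sqrt (a * K * b * q)" unfolding r_def real_sqrt_mult[symmetric] by (simp add: mult_ac)
      have qs: "q * s = r"
      proof -
        have "q * s = sqrt (q\<^sup>2) * s" using 3 by simp
        also have "\<dots> = sqrt (q\<^sup>2 * (a * K * b / q))" unfolding s_def real_sqrt_mult[symmetric] ..
        also have "q\<^sup>2 * (a * K * b / q) = a * K * b * q" using 3 by (simp add: power2_eq_square)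
        finally show ?thesis unfolding r .
      qed
      have "a * K * b = q * s * s" using ss 3 by (simp add: mult.assoc)
      hence "a * K * b / s = r" unfolding qs using s0 by simp
      thus ?thesis using s qs \<epsilon> by (intro exI[of _ s]) simp
    qed
  qed
  then obtain s where s: "s > a" "q * s + a * K * b / s < 2 * r + \<epsilon>" by blast
  define t where "t = c * (s - a) / (a + b)"
  have t: "t > 0" unfolding t_def using s a b c by simp
  have "- t + K / (a / t + b / (c + t)) = c / (a + b)\<^sup>2 * (K * b + a * q - q * s - a * K * b / s)"
    using optimal_shift_value[OF a b c s(1), of K] unfolding t_def q_def by simp
  also have "\<dots> > c / (a + b)\<^sup>2 * (\<mu> * ((a + b)\<^sup>2 / c))"
    by (rule mult_strict_left_mono[OF _ cm]) (use s(2) in \<open>simp add: \<epsilon>_def\<close>)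
  also have "c / (a + b)\<^sup>2 * (\<mu> * ((a + b)\<^sup>2 / c)) = \<mu>" using a b c by simp
  finally show ?thesis using t by blast
qed

section \<open>Column selection\<close>

text \<open>For an eigenvector \<open>v\<close>, the number \<open>x * (v \<bullet> v)\<close> is
  the squared norm of \<open>V^T v\<close>.\<close>

lemma gram_eigenvalue_nonneg:
  fixes V :: "real mat"
  assumes V: "V \<in> carrier_mat n l" and x: "eigenvalue (V * transpose_mat V) x"
  shows "x \<ge> 0"
proof -
  let ?Vt = "transpose_mat V"
  from x obtain v where v: "v \<in> carrier_vec n" "v \<noteq> 0\<^sub>v n" and e: "(V * ?Vt) *\<^sub>v v = x \<cdot>\<^sub>v v"
    using V unfolding eigenvalue_def eigenvector_def by auto
  have nn: "w \<bullet> w \<ge> 0" for w :: "real vec" unfolding scalar_prod_def by (intro sum_nonneg) auto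
  have w: "?Vt *\<^sub>v v \<in> carrier_vec l" using V v by auto
  have "(V * ?Vt) *\<^sub>v v = V *\<^sub>v (?Vt *\<^sub>v v)"
    by (rule assoc_mult_mat_vec[of _ n l _ n]) (use V v in auto)
  hence "v \<bullet> (x \<cdot>\<^sub>v v) = v \<bullet> (V *\<^sub>v (?Vt *\<^sub>v v))" unfolding e by simp
  also have "\<dots> = (?Vt *\<^sub>v v) \<bullet> (?Vt *\<^sub>v v)"
    using transpose_vec_mult_scalar[OF V w v(1)] V v w
    by (metis comm_scalar_prod mult_mat_vec_carrier)
  finally have "x * (v \<bullet> v) \<ge> 0" using nn[of "?Vt *\<^sub>v v"] v by simp
  moreover have "v \<bullet> v > 0"
    using nn[of v] conjugate_square_eq_0_vec[OF v(1)] v(2) by (simp add: less_eq_real_def)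
  ultimately show ?thesis by (simp add: zero_le_mult_iff)
qed

lemma eigenvalue_one_minus:
  fixes A :: "real mat"
  assumes A: "A \<in> carrier_mat n n"
  shows "eigenvalue (1\<^sub>m n - A) x \<longleftrightarrow> eigenvalue A (1 - x)"
proof -
  have B: "1\<^sub>m n - A \<in> carrier_mat n n" using A by auto
  have eq: "- char_matrix A (1 - x) = (1 - x) \<cdot>\<^sub>m 1\<^sub>m n - A"
    unfolding char_matrix_def using A by (intro eq_matI) auto
  show ?thesis
    unfolding eigenvalue_root_char_poly[OF B] eigenvalue_root_char_poly[OF A]
      poly_char_poly_one_minus[OF A] char_poly_matrix[OF A] eq by simp
qed

section \<open>Column submatrices and their Gram matrices\<close>

lemma bij_betw_pick:
  assumes "finite S"
  shows "bij_betw (pick S) {..<card S} S"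
proof -
  have "inj_on (pick S) {..<card S}"
    by (rule linorder_inj_onI') (use pick_mono[of _ S] in \<open>fastforce simp: less_imp_neq\<close>)
  moreover have "pick S ` {..<card S} \<subseteq> S" using pick_in_set[of _ S] by auto
  ultimately show ?thesis
    unfolding bij_betw_def using assms by (metis card_image card_lessThan card_subset_eq)
qed

lemma cols_submatrix_carrier:
  assumes "Y \<in> carrier_mat n N" and "S \<subseteq> {0..<N}"
  shows "cols_submatrix Y S \<in> carrier_mat n (card S)"
proof -
  have "{j. j < N \<and> j \<in> S} = S" using assms(2) by auto
  thus ?thesis using assms(1) unfolding cols_submatrix_def
    by (intro carrier_matI) (simp_all add: dim_submatrix)
qed

lemma cols_submatrix_index:
  assumes "Y \<in> carrier_mat n N" and "S \<subseteq> {0..<N}" and "i < n" and "j < card S"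
  shows "cols_submatrix Y S $$ (i,j) = Y $$ (i, pick S j)"
proof -
  have "{j. j < N \<and> j \<in> S} = S" using assms(2) by auto
  thus ?thesis using assms(1,3,4) unfolding cols_submatrix_def
    by (subst submatrix_index) (simp_all add: pick_UNIV)
qed

text \<open>The order in which \<open>pick\<close> lists the columns disappears, so a partition of
  the index set becomes a sum of Gram matrices.\<close>

lemma cols_submatrix_gram:
  fixes Y :: "real mat"
  assumes Y: "Y \<in> carrier_mat n N" and S: "S \<subseteq> {0..<N}" and ij: "i < n" "j < n"
  shows "(cols_submatrix Y S * transpose_mat (cols_submatrix Y S)) $$ (i,j) = (\<Sum>p\<in>S. Y $$ (i,p) * Y $$ (j,p))"
proof -
  have c: "cols_submatrix Y S \<in> carrier_mat n (card S)" by (rule cols_submatrix_carrier[OF Y S])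
  have fin: "finite S" using S finite_subset by blast
  have "(cols_submatrix Y S * transpose_mat (cols_submatrix Y S)) $$ (i,j)
      = (\<Sum>q<card S. Y $$ (i, pick S q) * Y $$ (j, pick S q))"
    using c ij by (simp add: scalar_prod_def atLeast0LessThan cols_submatrix_index[OF Y S])
  also have "\<dots> = (\<Sum>p\<in>S. Y $$ (i,p) * Y $$ (j,p))"
    by (rule sum.reindex_bij_betw[OF bij_betw_pick[OF fin]])
  finally show ?thesis .
qed

lemma append_cols_gram:
  fixes A B :: "real mat"
  assumes A: "A \<in> carrier_mat n p" and B: "B \<in> carrier_mat n q"
  shows "append_cols A B * transpose_mat (append_cols A B) = A * transpose_mat A + B * transpose_mat B"
proof -
  have AB: "append_cols A B \<in> carrier_mat n (p + q)" unfolding append_cols_def using A B by auto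
  have ent: "append_cols A B $$ (i,j) = (if j < p then A $$ (i,j) else B $$ (i, j - p))"
    if "i < n" "j < p + q" for i j
    unfolding append_cols_def using A B that by auto
  show ?thesis
  proof (rule eq_matI)
    fix i j assume "i < dim_row (A * transpose_mat A + B * transpose_mat B)"
      "j < dim_col (A * transpose_mat A + B * transpose_mat B)"
    hence ij: "i < n" "j < n" using A B by auto
    let ?f = "\<lambda>k. append_cols A B $$ (i,k) * append_cols A B $$ (j,k)"
    have "(append_cols A B * transpose_mat (append_cols A B)) $$ (i,j) = (\<Sum>k<p + q. ?f k)"
      using AB ij by (simp add: scalar_prod_def atLeast0LessThan)
    also have "\<dots> = (\<Sum>k<p. ?f k) + (\<Sum>k<q. ?f (p + k))"
      by (induction q) (simp_all add: add.assoc)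
    also have "\<dots> = (\<Sum>k<p. A $$ (i,k) * A $$ (j,k)) + (\<Sum>k<q. B $$ (i,k) * B $$ (j,k))"
      using ij by (simp add: ent)
    also have "\<dots> = (A * transpose_mat A + B * transpose_mat B) $$ (i,j)"
      using A B ij by (simp add: scalar_prod_def atLeast0LessThan)
    finally show "(append_cols A B * transpose_mat (append_cols A B)) $$ (i,j)
      = (A * transpose_mat A + B * transpose_mat B) $$ (i,j)" .
  qed (use A B AB in auto)
qed

text \<open>\<open>Min\<close> is informative only for a finite nonempty set; diagonalisation and
  \<open>n \<ge> 1\<close> provide both properties.\<close>

lemma sigma_min_sq_ge:
  fixes Z :: "real mat"
  assumes Z: "Z \<in> carrier_mat n p" and n: "n \<ge> 1"
    and ev: "\<And>x. eigenvalue (Z * transpose_mat Z) x \<Longrightarrow> x \<ge> y"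
  shows "sigma_min_sq Z \<ge> y"
proof -
  have c: "Z * transpose_mat Z \<in> carrier_mat n n" using Z by auto
  have sym: "transpose_mat (Z * transpose_mat Z) = Z * transpose_mat Z"
    using Z by (simp add: transpose_mult_dim)
  obtain e where e: "\<And>x. eigenvalue (Z * transpose_mat Z) x \<longleftrightarrow> (\<exists>i<n. x = e i)"
    using symmetric_char_poly_factors[OF c sym] by blast
  have eq: "{x. eigenvalue (Z * transpose_mat Z) x} = e ` {..<n}" using e by auto
  have "finite {x. eigenvalue (Z * transpose_mat Z) x}" "{x. eigenvalue (Z * transpose_mat Z) x} \<noteq> {}"
    unfolding eq using n by (auto simp: lessThan_empty_iff)
  thus ?thesis unfolding sigma_min_sq_def using ev by (subst Min_ge_iff) auto
qed

text \<open>The selection for one fixed starting point \<open>- t\<close>. The first two conclusions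
  come from the same spectral data and are used afterwards in choosing \<open>t\<close>.\<close>

lemma subset_selection_barrier:
  fixes Y M :: "real mat"
  assumes n: "n \<ge> 1" and Y: "Y \<in> carrier_mat n (m + l)" and YY: "Y * transpose_mat Y = 1\<^sub>m n"
    and SM: "S\<^sub>M \<subseteq> {0..<m + l}" and cSM: "card S\<^sub>M = l" and M: "M = cols_submatrix Y S\<^sub>M"
    and a: "a = n - vec_space.rank n M" and ak: "a \<le> k" and km: "k < m"
    and b: "b = real m - real a"
    and H: "H = real m - real n + (frobenius_norm (pseudoinverse M))\<^sup>2" and t: "t > 0"
  shows "vec_space.rank n M \<le> n" and "H > 0"
    and "\<exists>S\<^sub>0 \<subseteq> {0..<m + l} - S\<^sub>M. card S\<^sub>0 = k \<and>
      sigma_min_sq (append_cols M (cols_submatrix Y S\<^sub>0)) \<ge> - t + (real k + 1) / (a / t + b / (b / H + t))"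
proof -
  define R where "R = {0..<m + l} - S\<^sub>M"
  have finSM: "finite S\<^sub>M" using SM finite_subset by blast
  have finR: "finite R" and cR: "card R = m" unfolding R_def
    using SM cSM finSM by (auto simp: card_Diff_subset)
  obtain f where f: "bij_betw f {..<m} R" using bij_betw_pick[OF finR] cR by auto
  have Mc: "M \<in> carrier_mat n l" unfolding M using cols_submatrix_carrier[OF Y SM] cSM by simp
  have fullsum: "(\<Sum>p\<in>{0..<m + l}. Y $$ (i,p) * Y $$ (j,p)) = (if i = j then 1 else 0)"
    if "i < n" "j < n" for i j
  proof -
    have "(Y * transpose_mat Y) $$ (i,j) = (\<Sum>p\<in>{0..<m + l}. Y $$ (i,p) * Y $$ (j,p))"
      using Y that by (simp add: scalar_prod_def)
    thus ?thesis unfolding YY using that by simp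
  qed
  have gram_cols: "(mat n d (\<lambda>(i,j). Y $$ (i, g j)) * transpose_mat (mat n d (\<lambda>(i,j). Y $$ (i, g j)))) $$ (i,j)
      = (\<Sum>p\<in>g ` {..<d}. Y $$ (i,p) * Y $$ (j,p))"
    if "inj_on g {..<d}" "i < n" "j < n" for g d i j
    using that by (simp add: scalar_prod_def atLeast0LessThan sum.reindex)
  \<comment> \<open>\<open>W\<close> lists the columns outside \<open>S\<^sub>M\<close> in the order
    of \<open>f\<close>, so \<open>Y Y^T = 1\<close> splits into
    \<open>W W^T + M M^T = 1\<close>.\<close>
  define W where "W = mat n m (\<lambda>(i,j). Y $$ (i, f j))"
  have W: "W \<in> carrier_mat n m" unfolding W_def by simp
  have WW: "1\<^sub>m n - W * transpose_mat W = M * transpose_mat M"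
  proof (rule eq_matI)
    fix i j assume "i < dim_row (M * transpose_mat M)" "j < dim_col (M * transpose_mat M)"
    hence ij: "i < n" "j < n" using Mc by auto
    have 1: "(W * transpose_mat W) $$ (i,j) = (\<Sum>p\<in>R. Y $$ (i,p) * Y $$ (j,p))"
      unfolding W_def using gram_cols[OF bij_betw_imp_inj_on[OF f] ij] bij_betw_imp_surj_on[OF f] by simp
    have 2: "(M * transpose_mat M) $$ (i,j) = (\<Sum>p\<in>S\<^sub>M. Y $$ (i,p) * Y $$ (j,p))"
      unfolding M by (rule cols_submatrix_gram[OF Y SM ij])
    have 3: "(\<Sum>p\<in>{0..<m + l}. Y $$ (i,p) * Y $$ (j,p))
        = (\<Sum>p\<in>R. Y $$ (i,p) * Y $$ (j,p)) + (\<Sum>p\<in>S\<^sub>M. Y $$ (i,p) * Y $$ (j,p))"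
      unfolding R_def by (rule sum.subset_diff[OF SM]) simp
    have "(1\<^sub>m n - W * transpose_mat W) $$ (i,j) = (if i = j then 1 else 0) - (W * transpose_mat W) $$ (i,j)"
      using ij W by (simp del: index_mult_mat(1))
    thus "(1\<^sub>m n - W * transpose_mat W) $$ (i,j) = (M * transpose_mat M) $$ (i,j)"
      using fullsum[OF ij] 1 2 3 by linarith
  qed (use W Mc in auto)
  have MMc: "M * transpose_mat M \<in> carrier_mat n n" using Mc by auto
  have MMs: "transpose_mat (M * transpose_mat M) = M * transpose_mat M"
    using Mc by (simp add: transpose_mult_dim)
  from real_symmetric_diagonalization[OF MMc MMs] obtain U e where
    orth: "U \<in> carrier_mat n n" "transpose_mat U * U = 1\<^sub>m n" "U * transpose_mat U = 1\<^sub>m n"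
    and MU: "M * transpose_mat M = U * mat_diag n e * transpose_mat U" by blast
  interpret G: gram_diagonalization M U n l e by unfold_locales (rule Mc orth(1,2) MU)+
  have cpM: "char_poly (M * transpose_mat M) = (\<Prod>i<n. [:- e i, 1:])"
    unfolding MU by (rule char_poly_mat_diag_conjugate[OF orth])
  have e0: "e i \<ge> 0" if "i < n" for i
    using gram_eigenvalue_nonneg[OF Mc] eigenvalue_iff_factor[OF MMc cpM] that by blast
  define C where "C = 1\<^sub>m m - transpose_mat W * W"
  have C: "C \<in> carrier_mat m m" unfolding C_def using W by auto
  have symC: "transpose_mat C = C"
  proof -
    have WtW: "transpose_mat W * W \<in> carrier_mat m m" using W by auto
    show ?thesis unfolding C_def using W
      by (simp add: transpose_minus[OF one_carrier_mat WtW] transpose_mult_dim)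
  qed
  obtain z where cpC: "char_poly C = (\<Prod>i<m. [:- z i, 1:])"
    and evC: "\<And>x. eigenvalue C x \<longleftrightarrow> (\<exists>i<m. x = z i)"
    using symmetric_char_poly_factors[OF C symC] by blast
  have spec: "(\<Sum>i<m. h (z i)) = (\<Sum>i<n. h (e i)) + (real m - real n) * h 1" for h :: "real \<Rightarrow> real"
    by (rule gram_spectrum_sum[OF W]) (use cpM cpC in \<open>simp_all add: WW C_def\<close>)
  have z0: "z i \<ge> 0" if i: "i < m" for i
  proof -
    \<comment> \<open>The indicator of the negative numbers transfers nonnegativity from the
      \<open>e i\<close> to the \<open>z i\<close>; the surplus term vanishes as
      \<open>h 1 = 0\<close>.\<close>
    define h :: "real \<Rightarrow> real" where "h x = (if x < 0 then 1 else 0)" for x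
    have "(\<Sum>i<n. h (e i)) = 0" using e0 unfolding h_def by (intro sum.neutral) (auto simp: not_less)
    hence "(\<Sum>i<m. h (z i)) = 0" unfolding spec by (simp add: h_def)
    hence "h (z i) = 0" using i by (subst (asm) sum_nonneg_eq_0_iff) (auto simp: h_def)
    thus ?thesis by (simp add: h_def split: if_splits)
  qed
  have split: "n = card {i. i < n \<and> e i \<noteq> 0} + card {i. i < n \<and> e i = 0}"
  proof -
    have "{..<n} = {i. i < n \<and> e i \<noteq> 0} \<union> {i. i < n \<and> e i = 0}" by auto
    thus ?thesis by (metis (mono_tags, lifting) card_Un_disjoint card_lessThan disjoint_iff finite_Un finite_lessThan mem_Collect_eq)
  qed
  show rn: "vec_space.rank n M \<le> n" unfolding G.rank_eq using split by linarith
  have cardz: "card {i. i < m \<and> z i = 0} = a"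
  proof -
    \<comment> \<open>The indicator of 0 also vanishes at 1, so \<open>C\<close> and
      \<open>M M^T\<close> have the same nullity, namely \<open>n\<close> minus the rank of
      \<open>M\<close>.\<close>
    define h :: "real \<Rightarrow> real" where "h x = (if x = 0 then 1 else 0)" for x
    have cnt: "(\<Sum>i<k. h (y i)) = real (card {i. i < k \<and> y i = 0})" for y and k :: nat
    proof -
      have "(\<Sum>i<k. h (y i)) = (\<Sum>i\<in>{i. i < k \<and> y i = 0}. 1)"
        unfolding h_def by (rule sum.mono_neutral_cong_right) auto
      thus ?thesis by simp
    qed
    have "real (card {i. i < m \<and> z i = 0}) = real (card {i. i < n \<and> e i = 0})"
      using spec[of h] unfolding cnt by (simp add: h_def)
    thus ?thesis unfolding a G.rank_eq using split by linarith
  qed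
  \<comment> \<open>For \<open>h = inverse\<close> the sum over the \<open>e i\<close> is the
    squared norm of the pseudoinverse, and the surplus term is \<open>m - n\<close>.\<close>
  have Hz: "(\<Sum>i<m. inverse (z i)) = H"
    unfolding spec H G.frobenius_norm_pseudoinverse by simp
  have am: "a < m" using ak km by simp
  note bound = sum_inverse_shift_le[OF z0 cardz Hz am t]
  show "H > 0" by (rule bound(1))
  define \<phi> where "\<phi> = a / t + b / (b / H + t)"
  have bar: "barrier C (- t) \<le> \<phi>"
  proof -
    have "barrier C (- t) = (\<Sum>i<m. 1 / (z i - (- t)))"
    proof (rule barrier_eq_sum[OF cpC])
      fix i assume "i < m" thus "z i \<noteq> - t" using z0[of i] t by auto
    qed
    thus ?thesis using bound(2) unfolding \<phi>_def b by simp
  qed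
  define d where "d = m - k"
  have d: "d \<ge> 1" "m = d + k" using km unfolding d_def by auto
  have evCt: "x > - t" if "eigenvalue C x" for x using that z0 t unfolding evC by force
  obtain g where g: "inj_on g {..<d}" "g ` {..<d} \<subseteq> {..<m}"
    and evg: "\<And>x. eigenvalue (principal_mat C d g) x \<Longrightarrow> x \<ge> - t + (real k + 1) / \<phi>"
    using barrier_iterate[OF C[unfolded d(2)] d(1) symC evCt bar] unfolding d(2)[symmetric] by auto
  \<comment> \<open>\<open>g\<close> lists the indices that survive the deletions, so
    \<open>V\<close> collects the columns that are not selected.\<close>
  define V where "V = mat n d (\<lambda>(i,j). Y $$ (i, (f \<circ> g) j))"
  have V: "V \<in> carrier_mat n d" unfolding V_def by simp
  have gm: "g j < m" if "j < d" for j using g(2) that by auto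
  have P: "principal_mat C d g = 1\<^sub>m d - transpose_mat V * V"
  proof (rule eq_matI)
    fix i j assume "i < dim_row (1\<^sub>m d - transpose_mat V * V)" "j < dim_col (1\<^sub>m d - transpose_mat V * V)"
    hence ij: "i < d" "j < d" using V by auto
    have "g i = g j \<longleftrightarrow> i = j" using g(1) ij unfolding inj_on_def by auto
    thus "principal_mat C d g $$ (i,j) = (1\<^sub>m d - transpose_mat V * V) $$ (i,j)"
      using ij gm[OF ij(1)] gm[OF ij(2)]
      by (simp add: principal_mat_def C_def W_def V_def scalar_prod_def)
  qed (use V in \<open>auto simp: principal_mat_def\<close>)
  have fg: "inj_on (f \<circ> g) {..<d}"
    using g bij_betw_imp_inj_on[OF f] by (meson comp_inj_on inj_on_subset)
  define T where "T = (f \<circ> g) ` {..<d}"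
  have TR: "T \<subseteq> R" using g(2) bij_betw_imp_surj_on[OF f] unfolding T_def by auto
  have cT: "card T = d" unfolding T_def using card_image[OF fg] by simp
  define S where "S = R - T"
  have SR: "S \<subseteq> R" unfolding S_def by auto
  have SN: "S \<subseteq> {0..<m + l}" using SR unfolding R_def by auto
  have cS: "card S = k" unfolding S_def using TR finR cR cT d by (simp add: card_Diff_subset finite_subset)
  define Z where "Z = append_cols M (cols_submatrix Y S)"
  have NSc: "cols_submatrix Y S \<in> carrier_mat n k" using cols_submatrix_carrier[OF Y SN] cS by simp
  have Z: "Z \<in> carrier_mat n (l + k)" unfolding Z_def append_cols_def using Mc NSc by auto
  have ZZ: "Z * transpose_mat Z = 1\<^sub>m n - V * transpose_mat V"
  proof -
    have "Z * transpose_mat Z = M * transpose_mat M + cols_submatrix Y S * transpose_mat (cols_submatrix Y S)"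
      unfolding Z_def by (rule append_cols_gram[OF Mc NSc])
    also have "\<dots> = 1\<^sub>m n - V * transpose_mat V"
    proof (rule eq_matI)
      fix i j assume "i < dim_row (1\<^sub>m n - V * transpose_mat V)" "j < dim_col (1\<^sub>m n - V * transpose_mat V)"
      hence ij: "i < n" "j < n" using V by auto
      let ?y = "\<lambda>p. Y $$ (i,p) * Y $$ (j,p)"
      have 1: "(V * transpose_mat V) $$ (i,j) = (\<Sum>p\<in>T. ?y p)"
        unfolding V_def T_def by (rule gram_cols[OF fg ij])
      have 2: "(M * transpose_mat M) $$ (i,j) = (\<Sum>p\<in>S\<^sub>M. ?y p)"
        unfolding M by (rule cols_submatrix_gram[OF Y SM ij])
      have 3: "(cols_submatrix Y S * transpose_mat (cols_submatrix Y S)) $$ (i,j) = (\<Sum>p\<in>S. ?y p)"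
        by (rule cols_submatrix_gram[OF Y SN ij])
      have 4: "(\<Sum>p\<in>{0..<m + l}. ?y p) = (\<Sum>p\<in>R. ?y p) + (\<Sum>p\<in>S\<^sub>M. ?y p)"
        unfolding R_def by (rule sum.subset_diff[OF SM]) simp
      have 5: "(\<Sum>p\<in>R. ?y p) = (\<Sum>p\<in>S. ?y p) + (\<Sum>p\<in>T. ?y p)"
        unfolding S_def by (rule sum.subset_diff[OF TR finR])
      have "(1\<^sub>m n - V * transpose_mat V) $$ (i,j) = (if i = j then 1 else 0) - (V * transpose_mat V) $$ (i,j)"
        using ij V by (simp del: index_mult_mat(1))
      moreover have "(M * transpose_mat M + cols_submatrix Y S * transpose_mat (cols_submatrix Y S)) $$ (i,j)
        = (M * transpose_mat M) $$ (i,j) + (cols_submatrix Y S * transpose_mat (cols_submatrix Y S)) $$ (i,j)"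
        using ij Mc NSc by (simp del: index_mult_mat(1))
      ultimately show "(M * transpose_mat M + cols_submatrix Y S * transpose_mat (cols_submatrix Y S)) $$ (i,j)
        = (1\<^sub>m n - V * transpose_mat V) $$ (i,j)"
        using fullsum[OF ij] 1 2 3 4 5 by linarith
    qed (use V Mc NSc in auto)
    finally show ?thesis .
  qed
  have Pc: "principal_mat C d g \<in> carrier_mat d d" unfolding principal_mat_def by simp
  have VtV: "transpose_mat V * V \<in> carrier_mat d d" using V by auto
  \<comment> \<open>1 can be an eigenvalue of \<open>Z Z^T\<close> without being one of the
    principal submatrix, so it is compared with the bound separately. The principal submatrix
    \<open>1 - V^T V\<close> has an eigenvalue since \<open>d \<ge> 1\<close>, and that lies between
    the bound and 1.\<close>
  have le1: "- t + (real k + 1) / \<phi> \<le> 1"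
  proof -
    have symP: "transpose_mat (principal_mat C d g) = principal_mat C d g"
      unfolding P using V by (simp add: transpose_minus[OF one_carrier_mat VtV] transpose_mult_dim)
    obtain y where y: "eigenvalue (principal_mat C d g) y"
      using real_symmetric_eigenvalue_exists[OF Pc symP] d by auto
    hence "eigenvalue (transpose_mat V * V) (1 - y)" unfolding P eigenvalue_one_minus[OF VtV] .
    hence "1 - y \<ge> 0" using gram_eigenvalue_nonneg[of "transpose_mat V" d n "1 - y"] V by simp
    thus ?thesis using evg[OF y] by linarith
  qed
  have "sigma_min_sq Z \<ge> - t + (real k + 1) / \<phi>"
  proof (rule sigma_min_sq_ge[OF Z n])
    fix x assume x: "eigenvalue (Z * transpose_mat Z) x"
    show "- t + (real k + 1) / \<phi> \<le> x"
    proof (cases "x = 1")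
      case False
      have Zc: "1\<^sub>m n - V * transpose_mat V \<in> carrier_mat n n" using V by auto
      \<comment> \<open>For \<open>x \<noteq> 1\<close> the power of \<open>x - 1\<close> on the
        other side of the identity is nonzero, so \<open>x\<close> is an eigenvalue of the principal
        submatrix.\<close>
      have "poly ([:-1, 1:] ^ d * char_poly (1\<^sub>m n - V * transpose_mat V)) x = 0"
        using x unfolding ZZ eigenvalue_root_char_poly[OF Zc] by simp
      hence "poly (char_poly (principal_mat C d g)) x = 0"
        unfolding char_poly_one_minus_gram[OF V] P[symmetric] using False by (simp add: poly_power)
      thus ?thesis using evg eigenvalue_root_char_poly[OF Pc] by blast
    qed (use le1 in simp)
  qed
  thus "\<exists>S\<^sub>0 \<subseteq> {0..<m + l} - S\<^sub>M. card S\<^sub>0 = k \<and>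
      sigma_min_sq (append_cols M (cols_submatrix Y S\<^sub>0)) \<ge> - t + (real k + 1) / (a / t + b / (b / H + t))"
    using SR cS unfolding R_def Z_def \<phi>_def by blast
qed

theorem theorem3p1:
  fixes Y M :: "real mat" and S\<^sub>M :: "nat set" and m n l k r :: nat
  assumes "n \<ge> 1"
    and "Y \<in> carrier_mat n (m + l)"
    and "Y * transpose_mat Y = 1\<^sub>m n"
    and "S\<^sub>M \<subseteq> {0..<m + l}"
    and "card S\<^sub>M = l"
    and "M = cols_submatrix Y S\<^sub>M"
    and "r = vec_space.rank n M"
    and "int n - int r \<le> int k"
    and "int k \<le> int m - 1"
  shows "\<exists>S\<^sub>0 \<subseteq> {0..<m + l} - S\<^sub>M. card S\<^sub>0 = k \<and>
    sigma_min_sq (append_cols M (cols_submatrix Y S\<^sub>0))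
      \<ge> inverse (Gamma_factor m n k r) *
        ((real m - real n + real r) /
         (real m - real n + (frobenius_norm (pseudoinverse M))\<^sup>2))"
proof (rule ccontr)
  assume neg: "\<not> ?thesis"
  define a where "a = n - r"
  define b where "b = real m - real a"
  define H where "H = real m - real n + (frobenius_norm (pseudoinverse M))\<^sup>2"
  define \<sigma> where "\<sigma> S = sigma_min_sq (append_cols M (cols_submatrix Y S))" for S
  define \<tau> where "\<tau> = inverse (Gamma_factor m n k r) * ((real m - real n + real r) / H)"
  have ak: "a \<le> k" and km: "k < m" using assms(8,9) unfolding a_def by linarith+
  have a_rank: "a = n - vec_space.rank n M" unfolding a_def assms(7) ..
  note sel = subset_selection_barrier[OF assms(1-6) a_rank ak km b_def H_def]
  \<comment> \<open>This makes the truncated difference \<open>n - r\<close> the true one. Any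
    positive starting point will do here, for instance 1.\<close>
  have rn: "r \<le> n" unfolding assms(7) using sel(1)[of 1] by simp
  have H: "H > 0" using sel(2)[of 1] by simp
  have b: "b > 0" unfolding b_def using ak km by simp
  have ra: "real n - real r = real a" unfolding a_def using rn by simp
  hence rb: "real m - real n + real r = b" unfolding b_def by simp
  \<comment> \<open>The target in the form of the optimisation lemma, with \<open>K = k + 1\<close>
    and \<open>c = b / H\<close>.\<close>
  have \<tau>: "\<tau> = (b / H) * (sqrt ((real k + 1) * b) - sqrt (a * (a + b - (real k + 1))))\<^sup>2 / (a + b)\<^sup>2"
  proof -
    have "real m - real k - 1 = a + b - (real k + 1)" "real m = a + b" unfolding b_def by simp_all
    thus ?thesis unfolding \<tau>_def Gamma_factor_def rb ra by (simp add: field_simps)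
  qed
  define F where "F = {S. S \<subseteq> {0..<m + l} - S\<^sub>M \<and> card S = k}"
  have finF: "finite F" unfolding F_def by (rule finite_subset[of _ "Pow {0..<m + l}"]) auto
  have lt: "\<sigma> S < \<tau>" if "S \<in> F" for S
    using neg that unfolding F_def \<sigma>_def \<tau>_def H_def by (auto simp: not_le)
  have F0: "F \<noteq> {}" using sel(3)[of 1] unfolding F_def by auto
  \<comment> \<open>As there are finitely many candidates, failure of the bound leaves a gap below
    the supremum \<open>\<tau>\<close>. Some \<open>t\<close> gives a value inside this gap, and the
    subset selected for it exceeds the maximum.\<close>
  have "Max (\<sigma> ` F) < \<tau>" using finF F0 lt by (subst Max_less_iff) auto
  from optimal_shift_exists[of "real a" b "b / H" "real k + 1", OF _ b _ _ _ this[unfolded \<tau>]]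
  obtain t where t: "t > 0" "Max (\<sigma> ` F) < - t + (real k + 1) / (a / t + b / (b / H + t))"
    using b H ak km unfolding b_def by auto
  from sel(3)[OF t(1)] obtain S where "S \<in> F" "\<sigma> S \<ge> - t + (real k + 1) / (a / t + b / (b / H + t))"
    unfolding F_def \<sigma>_def by auto
  moreover have "\<sigma> S \<le> Max (\<sigma> ` F)" using finF \<open>S \<in> F\<close> by auto
  ultimately show False using t(2) by linarith
qed

end
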